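(* Let $d\ge1$, let $1\le q<\infty$, and let $w$ be a discrete $A_q$-weight on $\mathbb{Z}^d$. Then an infinite matrix $A\in\mathcal{B}(\mathbb{Z}^d,\mathbb{Z}^d)$ has $\ell^q_w$-stability if and only if it has a left inverse in $\mathcal{B}(\mathbb{Z}^d,\mathbb{Z}^d)$, i.e. there is $B\in\mathcal{B}(\mathbb{Z}^d,\mathbb{Z}^d)$ with $BA=I$.
   Context: For $x=(x_1,\dots,x_d)\in\mathbb{R}^d$ put $|x|_\infty=\max(|x_1|,\dots,|x_d|)$. $\mathcal{B}(\mathbb{Z}^d,\mathbb{Z}^d)$ is the set of all complex infinite matrices $A=(a(i,j))_{i,j\in\mathbb{Z}^d}$ with $$\|A\|_{\mathcal{B}}:=\sum_{k\in\mathbb{Z}^d}\Big(\sup_{|i-j|_\infty\ge|k|_\infty}|a(i,j)|\Big)<\infty .$$ A positive sequence $w=(w(i))_{i\in\mathbb{Z}^d}$ is a discrete $A_q$-weight, for $1<q<\infty$, if there is a constant $C$ with $$\Big(N^{-d}\sum_{i\in a+[0,N-1]^d}w(i)\Big)\Big(N^{-d}\sum_{i\in a+[0,N-1]^d}w(i)^{-1/(q-1)}\Big)^{q-1}\le C$$ for all $a\in\mathbb{Z}^d$ and all integers $N\ge1$; it is a discrete $A_1$-weight if there is a constant $C$ with $N^{-d}\sum_{i\in a+[0,N-1]^d}w(i)\le C\inf_{i\in a+[0,N-1]^d}w(i)$ for all such $a,N$ (sums and infima over integer points). $\ell^q_w$ is the space of sequences $c=(c(i))_{i\in\mathbb{Z}^d}$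 with $\|c\|_{q,w}:=(\sum_i|c(i)|^qw(i))^{1/q}<\infty$. A matrix $A$ acts by $(Ac)(i)=\sum_{j}a(i,j)c(j)$. $A$ has $\ell^q_w$-stability if there is a positive constant $C$ such that $C^{-1}\|c\|_{q,w}\le\|Ac\|_{q,w}\le C\|c\|_{q,w}$ for all $c\in\ell^q_w$. $I$ is the identity matrix. *)

theory Defs
  imports "HOL-Analysis.Analysis"
begin

text \<open>The lattice \<open>\<int>\<^sup>d\<close> is the type \<^typ>\<open>int ^ 'd\<close> with \<open>d = CARD('d)\<close>; infinite matrices are
  functions of a row and a column index.\<close>

type_synonym 'd imatrix = "int ^ 'd \<Rightarrow> int ^ 'd \<Rightarrow> complex"

definition linf_norm :: "int ^ 'd \<Rightarrow> int" where
  "linf_norm x = Max (range (\<lambda>m. \<bar>x $ m\<bar>))"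

text \<open>Suprema and sums of the nonnegative quantities in the norm are taken in \<^typ>\<open>ennreal\<close>, where
  they always exist, so that finiteness of the norm is a genuine condition.\<close>

definition beurling_norm :: "'d::finite imatrix \<Rightarrow> ennreal" where
  "beurling_norm A =
     (\<Sum>\<^sub>\<infinity>k::int ^ 'd. SUP (i, j) \<in> {(i, j). linf_norm (i - j) \<ge> linf_norm k}. ennreal (cmod (A i j)))"

definition beurling_class :: "'d::finite imatrix set" where
  "beurling_class = {A. beurling_norm A < \<infinity>}"

definition cube :: "int ^ 'd \<Rightarrow> nat \<Rightarrow> (int ^ 'd) set" where
  "cube a N = {i. \<forall>m. a $ m \<le> i $ m \<and> i $ m \<le> a $ m + (int N - 1)}"

definition cube_avg :: "int ^ 'd \<Rightarrow> nat \<Rightarrow> (int ^ 'd \<Rightarrow> real) \<Rightarrow> real" where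
  "cube_avg a N f = (\<Sum>i\<in>cube a N. f i) / real N ^ CARD('d)"

text \<open>Only meaningful for \<open>q \<ge> 1\<close>.\<close>

definition discrete_weight :: "real \<Rightarrow> (int ^ 'd \<Rightarrow> real) \<Rightarrow> bool" where
  "discrete_weight q w \<longleftrightarrow>
     (\<forall>i. w i > 0) \<and>
     (if q = 1
      then \<exists>C. \<forall>a. \<forall>N\<ge>1. cube_avg a N w \<le> C * (INF i\<in>cube a N. w i)
      else \<exists>C. \<forall>a. \<forall>N\<ge>1.
             cube_avg a N w * cube_avg a N (\<lambda>i. w i powr (- 1 / (q - 1))) powr (q - 1) \<le> C)"

definition wlq :: "real \<Rightarrow> (int ^ 'd \<Rightarrow> real) \<Rightarrow> (int ^ 'd \<Rightarrow> complex) set" where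
  "wlq q w = {c. (\<lambda>i. cmod (c i) powr q * w i) summable_on UNIV}"

definition wlq_norm :: "real \<Rightarrow> (int ^ 'd \<Rightarrow> real) \<Rightarrow> (int ^ 'd \<Rightarrow> complex) \<Rightarrow> real" where
  "wlq_norm q w c = (\<Sum>\<^sub>\<infinity>i. cmod (c i) powr q * w i) powr (1 / q)"

definition imat_apply :: "'d imatrix \<Rightarrow> (int ^ 'd \<Rightarrow> complex) \<Rightarrow> int ^ 'd \<Rightarrow> complex" where
  "imat_apply A c = (\<lambda>i. \<Sum>\<^sub>\<infinity>j. A i j * c j)"

definition imat_mult :: "'d imatrix \<Rightarrow> 'd imatrix \<Rightarrow> 'd imatrix" where
  "imat_mult B A = (\<lambda>i j. \<Sum>\<^sub>\<infinity>k. B i k * A k j)"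

definition imat_id :: "'d imatrix" where
  "imat_id = (\<lambda>i j. if i = j then 1 else 0)"

text \<open>The first two conjuncts say that \<open>Ac\<close> is defined and that its norm is finite; they are explicit
  because \<open>infsum\<close> returns \<open>0\<close> on families that are not summable.\<close>

definition wlq_stable :: "real \<Rightarrow> (int ^ 'd \<Rightarrow> real) \<Rightarrow> 'd imatrix \<Rightarrow> bool" where
  "wlq_stable q w A \<longleftrightarrow>
     (\<exists>C>0. \<forall>c \<in> wlq q w.
        (\<forall>i. (\<lambda>j. A i j * c j) summable_on UNIV) \<and>
        imat_apply A c \<in> wlq q w \<and>
        inverse C * wlq_norm q w c \<le> wlq_norm q w (imat_apply A c) \<and>
        wlq_norm q w (imat_apply A c) \<le> C * wlq_norm q w c)"

end

theory Submission
  imports Defs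
begin

text \<open>If \<open>B\<close> is a left inverse, then \<open>c = B(Ac)\<close>, and stability follows since a radially decreasing
  summable kernel is a superposition of averages over cubes, which are bounded on \<open>\<ell>\<^sup>q\<^sub>w\<close> uniformly
  in the size of the cube.

  Conversely, let \<open>A\<close> be stable. Cut \<open>c\<close> off at scale \<open>N\<close> around a cell of the lattice \<open>N\<int>\<^sup>d\<close> and
  normalise local \<open>\<ell>\<^sup>q\<^sub>w\<close> norms by the weight of the cell. Because the commutator of \<open>A\<close> with the
  cutoff has small norm for large \<open>N\<close>, the local averages \<open>D(n)\<close> of \<open>c\<close> satisfy
  \<open>D(n) \<le> \<kappa> G(n) + \<Sum>\<^sub>p V(|n - p|) D(p)\<close> with \<open>G\<close> built from \<open>Ac\<close> and \<open>V\<close> of small mass; no weight is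
  left in this inequality. Absorbing \<open>V\<close> yields \<open>|c(i)| \<le> \<Sum>\<^sub>k \<Phi>(|i - k|) |(Ac)(k)|\<close> for finitely
  supported \<open>c\<close>, with \<open>\<Phi>\<close> decreasing and summable. So \<open>Ac \<mapsto> c(i)\<close> is dominated by a weighted
  \<open>\<ell>\<^sup>1\<close> norm; a Hahn-Banach extension of it is given by a row \<open>b(i,\<cdot>)\<close> with \<open>|b(i,k)| \<le> \<Phi>(|i - k|)\<close>,
  and these rows form the left inverse.\<close>

subsection \<open>Power inequalities\<close>

text \<open>Boundedness below does not by itself make the range of \<open>A\<close> complemented,
  and for general \<open>q\<close> and \<open>w\<close> there is no adjoint product to invert as in
  a Hilbert space; so there is no inverse operator at hand whose decay could be studied. The decay
  is therefore extracted from \<open>A\<close> itself, as an a priori inequality. Two uniformities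
  carry the argument. The constant \<kappa> is fixed by the stability constant, \<open>K\<close>,
  \<open>q\<close> and \<open>d\<close> before the scale \<open>N\<close> is chosen, so the mass of
  \<open>V\<close> can be made small although \<open>V\<close> contains the factor \<kappa>. And
  \<Phi> does not depend on \<open>i\<close>, so independently chosen rows have a common majorant.
  Finite supports make the absorption of \<open>V\<close> a subtraction of real numbers. Domination
  by a weighted l^1 norm is what excludes functionals on bounded sequences that see only the
  behaviour at infinity: what remains of a sequence after removal of finitely many coordinates is
  small in that norm.\<close>

lemma sum_powr_Jensen:
  fixes m y :: "'a \<Rightarrow> real"
  assumes "finite I" "1 \<le> q" "\<And>i. i \<in> I \<Longrightarrow> 0 \<le> m i" "\<And>i. i \<in> I \<Longrightarrow> 0 \<le> y i"
  shows "(\<Sum>i\<in>I. m i * y i) powr q \<le> (\<Sum>i\<in>I. m i) powr (q - 1) * (\<Sum>i\<in>I. m i * y i powr q)"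
proof -
  \<comment> \<open>Indices with \<open>y i = 0\<close> or \<open>m i = 0\<close> contribute to
    neither sum containing \<open>y\<close>. Without them the arguments are positive and the total
    mass, if any index remains, can be divided by.\<close>
  define I' where "I' = {i \<in> I. y i > 0 \<and> m i > 0}"
  have fin: "finite I'" using assms by (simp add: I'_def)
  have e1: "(\<Sum>i\<in>I. m i * y i) = (\<Sum>i\<in>I'. m i * y i)"
    using assms by (intro sum.mono_neutral_right) (auto simp: I'_def less_le)
  have e2: "(\<Sum>i\<in>I. m i * y i powr q) = (\<Sum>i\<in>I'. m i * y i powr q)"
    using assms by (intro sum.mono_neutral_right) (auto simp: I'_def less_le)
  have e3: "(\<Sum>i\<in>I'. m i) \<le> (\<Sum>i\<in>I. m i)"
    using assms by (intro sum_mono2) (auto simp: I'_def)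
  show ?thesis
  proof (cases "I' = {}")
    case True
    then show ?thesis using assms
      unfolding e1 e2 by simp
  next
    case False
    define M where "M = (\<Sum>i\<in>I'. m i)"
    have M: "M > 0" unfolding M_def using False fin by (intro sum_pos) (auto simp: I'_def)
    have "(\<Sum>i\<in>I'. (m i / M) *\<^sub>R y i) powr q \<le> (\<Sum>i\<in>I'. (m i / M) * y i powr q)"
      using M fin False assms(2)
      by (intro convex_on_sum[OF fin False powr_convex[of q]])
         (auto simp: I'_def sum_divide_distrib[symmetric] M_def)
    then have *: "((\<Sum>i\<in>I'. m i * y i) / M) powr q \<le> (\<Sum>i\<in>I'. m i * y i powr q) / M"
      by (simp add: sum_divide_distrib)
    have "(\<Sum>i\<in>I'. m i * y i) powr q = M powr q * ((\<Sum>i\<in>I'. m i * y i) / M) powr q"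
      using M by (subst powr_mult[symmetric]) (auto intro!: divide_nonneg_pos sum_nonneg simp: I'_def)
    also have "\<dots> \<le> M powr q * ((\<Sum>i\<in>I'. m i * y i powr q) / M)"
      by (intro mult_left_mono *) auto
    also have "\<dots> = M powr (q - 1) * (\<Sum>i\<in>I'. m i * y i powr q)"
      using M by (simp add: powr_diff)
    also have "\<dots> \<le> (\<Sum>i\<in>I. m i) powr (q - 1) * (\<Sum>i\<in>I'. m i * y i powr q)"
      using M e3 assms(2)
      by (intro mult_right_mono powr_mono2 sum_nonneg) (auto simp: M_def I'_def)
    finally show ?thesis unfolding e1 e2 .
  qed
qed

text \<open>With \<open>S\<close> the total, \<open>x i powr q\<close> is at most
  \<open>x i * S powr (q - 1)\<close>. This embedding of l^1 into l^q later turns inequalities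
  between \<open>q\<close>-th powers into linear ones.\<close>

lemma sum_powr_le_powr_sum:
  fixes x :: "'a \<Rightarrow> real"
  assumes "finite I" "1 \<le> q" "\<And>i. i \<in> I \<Longrightarrow> 0 \<le> x i"
  shows "(\<Sum>i\<in>I. x i powr q) \<le> (\<Sum>i\<in>I. x i) powr q"
proof -
  let ?S = "\<Sum>i\<in>I. x i"
  have S: "0 \<le> ?S" using assms by (auto intro: sum_nonneg)
  have le: "x i \<le> ?S" if "i \<in> I" for i using assms that by (intro member_le_sum) auto
  have "x i powr q \<le> x i * ?S powr (q - 1)" if "i \<in> I" for i
  proof -
    have "x i powr q = x i * x i powr (q - 1)"
      using assms that by (simp add: powr_mult_base)
    also have "\<dots> \<le> x i * ?S powr (q - 1)"
      using assms that le by (intro mult_left_mono powr_mono2) auto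
    finally show ?thesis .
  qed
  then have "(\<Sum>i\<in>I. x i powr q) \<le> ?S * ?S powr (q - 1)"
    by (simp add: sum_distrib_right sum_mono)
  also have "\<dots> = ?S powr q" using S by (simp add: powr_mult_base)
  finally show ?thesis .
qed

lemma powr_add3_le:
  fixes x y z :: real
  assumes "0 \<le> q" "0 \<le> x" "0 \<le> y" "0 \<le> z"
  shows "(x + y + z) powr q \<le> 3 powr q * (x powr q + y powr q + z powr q)"
proof -
  define M where "M = max x (max y z)"
  have "(x + y + z) powr q \<le> (3 * M) powr q"
    using assms by (intro powr_mono2) (auto simp: M_def)
  also have "\<dots> = 3 powr q * M powr q" by (rule powr_mult)
  also have "M powr q \<le> x powr q + y powr q + z powr q"
    unfolding M_def by (simp add: max_def)
  finally show ?thesis by simp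
qed

lemma powr_le_cancel_base: "x powr q \<le> y powr q \<Longrightarrow> 0 < q \<Longrightarrow> 0 \<le> y \<Longrightarrow> x \<le> (y :: real)"
  by (meson not_le powr_less_mono2)

subsection \<open>Lattice geometry\<close>

text \<open>Natural number values let radial profiles be functions on \<open>nat\<close>, rescaled
  by \<open>div\<close> and shifted by truncated subtraction.\<close>

definition lnorm :: "int ^ 'd::finite \<Rightarrow> nat" where
  "lnorm x = nat (linf_norm x)"

lemma linf_norm_ge: "\<bar>x $ m\<bar> \<le> linf_norm (x :: int ^ 'd::finite)"
  unfolding linf_norm_def by (intro Max_ge) auto

lemma linf_norm_nonneg: "0 \<le> linf_norm (x :: int ^ 'd::finite)"
  using linf_norm_ge[of x undefined] by linarith

lemma int_lnorm: "int (lnorm x) = linf_norm x"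
  unfolding lnorm_def using linf_norm_nonneg[of x] by simp

lemma linf_norm_le_iff: "linf_norm k \<le> linf_norm j \<longleftrightarrow> lnorm k \<le> lnorm j"
  by (simp flip: int_lnorm)

lemma lnorm_le_iff: "lnorm x \<le> n \<longleftrightarrow> (\<forall>m. \<bar>x $ m\<bar> \<le> int n)"
proof -
  have "lnorm x \<le> n \<longleftrightarrow> linf_norm x \<le> int n" by (simp flip: int_lnorm)
  also have "\<dots> \<longleftrightarrow> (\<forall>m. \<bar>x $ m\<bar> \<le> int n)"
    unfolding linf_norm_def by (subst Max_le_iff) auto
  finally show ?thesis .
qed

lemma lnorm_nth_le: "\<bar>x $ m\<bar> \<le> int (lnorm x)"
  by (simp add: int_lnorm linf_norm_ge)

lemma lnorm_triangle: "lnorm (x + y) \<le> lnorm x + lnorm y"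
  unfolding lnorm_le_iff
proof
  fix m show "\<bar>(x + y) $ m\<bar> \<le> int (lnorm x + lnorm y)"
    using lnorm_nth_le[of x m] lnorm_nth_le[of y m] by simp
qed

lemma lnorm_minus_commute: "lnorm (x - y) = lnorm (y - x)"
proof -
  have "lnorm (x - y) \<le> n \<longleftrightarrow> lnorm (y - x) \<le> n" for n
    by (simp add: lnorm_le_iff abs_minus_commute)
  then show ?thesis by (metis order_antisym order_refl)
qed

lemma lnorm_triangle3: "lnorm (x - z) \<le> lnorm (x - y) + lnorm (y - z)"
  using lnorm_triangle[of "x - y" "y - z"] by simp

lemma lnorm_zero [simp]: "lnorm 0 = 0"
  using lnorm_le_iff[of 0 0] by simp

lemma cube_eq_image:
  fixes a :: "int ^ 'd::finite"
  shows "cube a N = vec_lambda ` (\<Pi>\<^sub>E m\<in>UNIV. {a $ m ..< a $ m + int N})"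
proof -
  have "x \<in> vec_lambda ` (\<Pi>\<^sub>E m\<in>UNIV. {a $ m ..< a $ m + int N})"
    if "x \<in> cube a N" for x
    using that by (intro image_eqI[of _ _ "\<lambda>m. x $ m"]) (auto simp: cube_def PiE_iff zle_diff1_eq add_diff_eq)
  moreover have "x \<in> cube a N"
    if "x \<in> vec_lambda ` (\<Pi>\<^sub>E m\<in>UNIV. {a $ m ..< a $ m + int N})" for x
    using that by (auto simp: cube_def PiE_iff) (metis zle_diff1_eq add_diff_eq)
  ultimately show ?thesis by (intro equalityI subsetI)
qed

lemma finite_cube [simp]: "finite (cube (a :: int ^ 'd::finite) N)"
  unfolding cube_eq_image by (intro finite_imageI finite_PiE) auto

lemma card_cube: "card (cube (a :: int ^ 'd::finite) N) = N ^ CARD('d)"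
proof -
  have "inj_on vec_lambda (\<Pi>\<^sub>E m\<in>UNIV. {a $ m ..< a $ m + int N})"
    by (rule inj_on_subset[of _ UNIV]) (auto simp: inj_def vec_lambda_inject)
  then show ?thesis unfolding cube_eq_image
    by (simp add: card_image card_PiE)
qed

lemma ball_eq_cube: "{x. lnorm (x - a) \<le> n} = cube (a - (\<chi> m. int n)) (2 * n + 1)"
proof -
  have "lnorm (x - a) \<le> n \<longleftrightarrow> x \<in> cube (a - (\<chi> m. int n)) (2 * n + 1)" for x
  proof -
    have "\<bar>s - t\<bar> \<le> int n \<longleftrightarrow> t - int n \<le> s \<and> s \<le> t - int n + (int (2 * n + 1) - 1)" for s t
      by auto
    then show ?thesis
      unfolding lnorm_le_iff cube_def by (simp only: mem_Collect_eq vec_lambda_beta vector_minus_component)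
  qed
  then show ?thesis by (intro set_eqI) (simp only: mem_Collect_eq)
qed

lemma finite_ball [simp]: "finite {x. lnorm (x - (a :: int ^ 'd::finite)) \<le> n}"
  unfolding ball_eq_cube by simp

lemma card_ball: "card {x. lnorm (x - (a :: int ^ 'd::finite)) \<le> n} = (2 * n + 1) ^ CARD('d)"
  unfolding ball_eq_cube by (rule card_cube)

lemma card_ball': "card {x. lnorm ((a :: int ^ 'd::finite) - x) \<le> n} = (2 * n + 1) ^ CARD('d)"
  unfolding lnorm_minus_commute[of a] by (rule card_ball)

lemma finite_ball' [simp]: "finite {x. lnorm ((a :: int ^ 'd::finite) - x) \<le> n}"
  unfolding lnorm_minus_commute[of a] by simp

section \<open>Cells of side \<open>N\<close> and the distances between them\<close>

definition quot :: "nat \<Rightarrow> int ^ 'd \<Rightarrow> int ^ 'd" where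
  "quot N i = (\<chi> m. i $ m div int N)"

text \<open>The lower corner of cell \<open>p\<close>, while \<open>quot N i\<close> is the index of
  the cell containing \<open>i\<close>. Because \<open>div\<close> rounds down, the cells tile the
  whole lattice, negative coordinates included.\<close>

definition dil :: "nat \<Rightarrow> int ^ 'd \<Rightarrow> int ^ 'd" where
  "dil N p = (\<chi> m. int N * p $ m)"

lemma div_eq_iff_int: "N \<ge> 1 \<Longrightarrow> x div int N = p \<longleftrightarrow> int N * p \<le> x \<and> x \<le> int N * p + (int N - 1)"
proof -
  assume N: "N \<ge> 1"
  have "int N * (x div int N) + x mod int N = x" by (rule mult_div_mod_eq)
  moreover have "0 \<le> x mod int N" "x mod int N < int N" using N by auto
  moreover have "x div int N = p" if "int N * p \<le> x" "x \<le> int N * p + (int N - 1)"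
    using that N by (intro int_div_pos_eq[of _ _ _ "x - int N * p"]) auto
  ultimately show ?thesis by (metis add_le_cancel_left add_diff_cancel_left' diff_ge_0_iff_ge zle_diff1_eq le_add_same_cancel1)
qed

lemma mem_cube_dil_iff: "N \<ge> 1 \<Longrightarrow> i \<in> cube (dil N p) N \<longleftrightarrow> quot N i = p"
  by (auto simp: cube_def dil_def quot_def vec_eq_iff div_eq_iff_int)

text \<open>Together with \<open>lnorm_ge_quot\<close>: \<open>N\<close> times the distance of two
  cells differs from the distance of their points by at most \<open>N\<close>, so decay can be
  transferred between the two scales.\<close>

lemma lnorm_le_quot:
  assumes "N \<ge> 1"
  shows "lnorm (i - j) \<le> N * (lnorm (quot N i - quot N j) + 1)"
  unfolding lnorm_le_iff
proof
  fix m
  let ?r = "lnorm (quot N i - quot N j)"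
  let ?p = "i $ m div int N" and ?p' = "j $ m div int N"
  have "int N * ?p \<le> i $ m \<and> i $ m \<le> int N * ?p + (int N - 1)"
    "int N * ?p' \<le> j $ m \<and> j $ m \<le> int N * ?p' + (int N - 1)"
    using div_eq_iff_int[OF assms] by blast+
  then have "\<bar>i $ m - j $ m\<bar> \<le> \<bar>int N * ?p - int N * ?p'\<bar> + int N"
    by linarith
  also have "\<bar>int N * ?p - int N * ?p'\<bar> = int N * \<bar>?p - ?p'\<bar>"
    by (simp add: abs_mult flip: right_diff_distrib)
  also have "int N * \<bar>?p - ?p'\<bar> \<le> int N * int ?r"
    using lnorm_nth_le[of "quot N i - quot N j" m] by (intro mult_left_mono) (auto simp: quot_def)
  finally show "\<bar>(i - j) $ m\<bar> \<le> int (N * (?r + 1))"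
    by (simp add: algebra_simps)
qed

lemma lnorm_ge_quot:
  assumes "N \<ge> 1"
  shows "N * lnorm (quot N i - quot N j) \<le> lnorm (i - j) + N"
proof -
  have "\<exists>m. int (lnorm x) = \<bar>x $ m\<bar>" for x :: "int ^ 'a"
  proof -
    have "linf_norm x \<in> range (\<lambda>m. \<bar>x $ m\<bar>)"
      unfolding linf_norm_def by (rule Max_in) auto
    then show ?thesis by (auto simp: int_lnorm)
  qed
  then obtain m where m: "int (lnorm (quot N i - quot N j)) = \<bar>(quot N i - quot N j) $ m\<bar>"
    by blast
  let ?p = "i $ m div int N" and ?p' = "j $ m div int N"
  have "int N * ?p \<le> i $ m \<and> i $ m \<le> int N * ?p + (int N - 1)"
    "int N * ?p' \<le> j $ m \<and> j $ m \<le> int N * ?p' + (int N - 1)"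
    using div_eq_iff_int[OF assms] by blast+
  then have "\<bar>int N * ?p - int N * ?p'\<bar> \<le> \<bar>i $ m - j $ m\<bar> + int N"
    by linarith
  also have "\<bar>int N * ?p - int N * ?p'\<bar> = int N * \<bar>?p - ?p'\<bar>"
    by (simp add: abs_mult flip: right_diff_distrib)
  finally have "int N * \<bar>?p - ?p'\<bar> \<le> \<bar>i $ m - j $ m\<bar> + int N" .
  moreover have "\<bar>i $ m - j $ m\<bar> \<le> int (lnorm (i - j))"
    using lnorm_nth_le[of "i - j" m] by simp
  ultimately have "int (N * lnorm (quot N i - quot N j)) \<le> int (lnorm (i - j) + N)"
    using m by (simp add: quot_def)
  then show ?thesis by linarith
qed

text \<open>A block of neighbouring cells is again a cube, so the weight condition applies to it
  directly.\<close>

lemma quot_near_eq_cube: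
  assumes "N \<ge> 1"
  shows "{i. lnorm (quot N i - n) \<le> r} = cube (dil N (n - (\<chi> m. int r))) ((2 * r + 1) * N)"
proof -
  have *: "\<bar>x div int N - k\<bar> \<le> int r \<longleftrightarrow>
      int N * (k - int r) \<le> x \<and> x \<le> int N * (k - int r) + (int ((2 * r + 1) * N) - 1)" for x k
  proof -
    have "int N * (x div int N) \<le> x \<and> x \<le> int N * (x div int N) + (int N - 1)"
      using div_eq_iff_int[OF assms] by blast
    moreover have div_ge: "t \<le> x div int N \<longleftrightarrow> int N * t \<le> x" for t
    proof
      assume "t \<le> x div int N"
      then have "int N * t \<le> int N * (x div int N)" by (intro mult_left_mono) auto
      also have "\<dots> \<le> x" using div_eq_iff_int[OF assms, of x "x div int N"] by simp
      finally show "int N * t \<le> x" .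
    next
      assume "int N * t \<le> x"
      then have "(int N * t) div int N \<le> x div int N" using assms by (intro zdiv_mono1) auto
      then show "t \<le> x div int N" using assms by simp
    qed
    moreover have "\<bar>x div int N - k\<bar> \<le> int r \<longleftrightarrow> k - int r \<le> x div int N \<and> \<not> (k + int r + 1 \<le> x div int N)"
      by linarith
    moreover have "int N * (k + int r + 1) = int N * (k - int r) + int ((2 * r + 1) * N)"
      by (simp add: algebra_simps)
    ultimately show ?thesis unfolding div_ge by linarith
  qed
  show ?thesis
    unfolding lnorm_le_iff cube_def dil_def quot_def by (auto simp only: * vec_lambda_beta vector_minus_component)
qed

text \<open>After swapping the sums, each \<open>j\<close> is counted once for every
  \<open>p\<close> in a ball around \<open>g j\<close>.\<close>

lemma overlap_sum_le:
  fixes g :: "'a \<Rightarrow> int ^ 'd::finite" and f :: "'a \<Rightarrow> real"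
  assumes "finite P" "finite J" "\<And>j. j \<in> J \<Longrightarrow> 0 \<le> f j"
  shows "(\<Sum>p\<in>P. \<Sum>j\<in>{j\<in>J. lnorm (g j - p) \<le> r}. f j) \<le> real ((2 * r + 1) ^ CARD('d)) * (\<Sum>j\<in>J. f j)"
proof -
  have "(\<Sum>p\<in>P. \<Sum>j\<in>{j\<in>J. lnorm (g j - p) \<le> r}. f j)
      = (\<Sum>j\<in>J. \<Sum>p\<in>{p\<in>P. lnorm (g j - p) \<le> r}. f j)"
    using assms by (intro sum.swap_restrict)
  also have "\<dots> = (\<Sum>j\<in>J. real (card {p\<in>P. lnorm (g j - p) \<le> r}) * f j)"
    by simp
  also have "\<dots> \<le> (\<Sum>j\<in>J. real ((2 * r + 1) ^ CARD('d)) * f j)"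
  proof (intro sum_mono mult_right_mono)
    fix j
    have "card {p\<in>P. lnorm (g j - p) \<le> r} \<le> card {p. lnorm (g j - p) \<le> r}"
      by (intro card_mono finite_ball') auto
    then show "real (card {p\<in>P. lnorm (g j - p) \<le> r}) \<le> real ((2 * r + 1) ^ CARD('d))"
      unfolding card_ball' of_nat_le_iff .
  qed (use assms in auto)
  finally show ?thesis by (simp add: sum_distrib_left)
qed

subsection \<open>Radial kernels\<close>

text \<open>\<open>radial_kernel TYPE('d) u S\<close>: \<open>u\<close> is a decreasing profile whose sum \<open>\<Sum>u(|k|)\<close> over \<open>\<int>\<^sup>d\<close>
  is at most \<open>S\<close>. A matrix lies in the Beurling class iff \<open>|a(i,j)| \<le> u(|i - j|)\<close> for such a \<open>u\<close>. The
  type argument is needed because \<open>u\<close> does not determine \<open>d\<close>.\<close>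

definition radial_kernel :: "'d::finite itself \<Rightarrow> (nat \<Rightarrow> real) \<Rightarrow> real \<Rightarrow> bool" where
  "radial_kernel T u S \<longleftrightarrow> antimono u \<and> (\<forall>n. 0 \<le> u n) \<and>
     (\<forall>F :: (int ^ 'd) set. finite F \<longrightarrow> (\<Sum>k\<in>F. u (lnorm k)) \<le> S)"

lemma radial_kernelD:
  assumes "radial_kernel TYPE('d::finite) u S"
  shows "n \<le> m \<Longrightarrow> u m \<le> u n" "0 \<le> u n"
    "finite F \<Longrightarrow> (\<Sum>k\<in>F. u (lnorm ((a :: int ^ 'd) - k))) \<le> S"
    "finite F \<Longrightarrow> (\<Sum>k\<in>F. u (lnorm (k - (a :: int ^ 'd)))) \<le> S"
    "0 \<le> S"
proof -
  show "n \<le> m \<Longrightarrow> u m \<le> u n" "0 \<le> u n"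
    using assms by (auto simp: radial_kernel_def antimono_def)
  show *: "(\<Sum>k\<in>F. u (lnorm (k - a))) \<le> S" if "finite F" for F and a :: "int ^ 'd"
  proof -
    have "(\<Sum>k\<in>F. u (lnorm (k - a))) = (\<Sum>k\<in>(\<lambda>k. k - a) ` F. u (lnorm k))"
      by (subst sum.reindex) (auto simp: inj_on_def)
    also have "\<dots> \<le> S" using assms that by (simp add: radial_kernel_def)
    finally show ?thesis .
  qed
  then show "finite F \<Longrightarrow> (\<Sum>k\<in>F. u (lnorm (a - k))) \<le> S"
    by (simp add: lnorm_minus_commute[of a])
  show "0 \<le> S" using *[of "{}"] by simp
qed

lemma radial_kernel_mono:
  assumes "radial_kernel T v S" "\<And>n. u n \<le> v n" "antimono u" "\<And>n. 0 \<le> u n"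
  shows "radial_kernel T u S"
  using assms unfolding radial_kernel_def by (meson order_trans sum_mono)

lemma radial_kernel_le: "radial_kernel T u S \<Longrightarrow> S \<le> S' \<Longrightarrow> radial_kernel T u S'"
  unfolding radial_kernel_def by (meson order_trans)

lemma radial_kernel_add:
  "radial_kernel T u S \<Longrightarrow> radial_kernel T v S' \<Longrightarrow> radial_kernel T (\<lambda>r. u r + v r) (S + S')"
  unfolding radial_kernel_def antimono_def by (auto simp: sum.distrib intro: add_mono)

lemma radial_kernel_cmult:
  "radial_kernel T u S \<Longrightarrow> 0 \<le> c \<Longrightarrow> radial_kernel T (\<lambda>r. c * u r) (c * S)"
  unfolding radial_kernel_def antimono_def
  by (auto simp flip: sum_distrib_left intro: mult_left_mono)

lemma radial_kernel_ball:
  "radial_kernel TYPE('d::finite) (\<lambda>r. if r \<le> R then 1 else 0) (real ((2 * R + 1) ^ CARD('d)))"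
  unfolding radial_kernel_def
proof (intro conjI allI impI)
  fix F :: "(int ^ 'd) set" assume F: "finite F"
  have "(\<Sum>k\<in>F. if lnorm k \<le> R then 1 else 0 :: real) = real (card (F \<inter> {k. lnorm k \<le> R}))"
    using F by (simp add: sum.If_cases)
  also have "card (F \<inter> {k. lnorm k \<le> R}) \<le> card {k :: int ^ 'd. lnorm (k - 0) \<le> R}"
    by (intro card_mono finite_ball) auto
  finally show "(\<Sum>k\<in>F. if lnorm k \<le> R then 1 else 0 :: real) \<le> real ((2 * R + 1) ^ CARD('d))"
    unfolding card_ball by simp
qed (auto simp: antimono_def)

text \<open>Stretching by \<open>M\<close> is controlled by a coarse map \<open>t\<close> that
  shrinks norms by the factor \<open>M\<close> and has fibres inside balls of radius
  \<open>M - 1\<close>.\<close>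

lemma radial_kernel_div:
  assumes u: "radial_kernel TYPE('d::finite) u S" and M: "1 \<le> M"
  shows "radial_kernel TYPE('d) (\<lambda>r. u (r div M)) (real ((2 * M) ^ CARD('d)) * S)"
  unfolding radial_kernel_def
proof (intro conjI allI impI)
  note u_mono = radial_kernelD(1)[OF u] and u_nonneg = radial_kernelD(2)[OF u]
  show "antimono (\<lambda>r. u (r div M))"
    unfolding antimono_def by (auto intro!: u_mono div_le_mono)
  show "0 \<le> u (n div M)" for n by (rule u_nonneg)
  fix F :: "(int ^ 'd) set" assume F: "finite F"
  \<comment> \<open>Rounding is towards zero, unlike in \<open>quot\<close>: rounding down would
    send -1 to -1 and violate the bound \<open>lnorm (t x) \<le> lnorm x div M\<close>.\<close>
  define t :: "int ^ 'd \<Rightarrow> int ^ 'd" where "t x = (\<chi> m. sgn (x $ m) * (\<bar>x $ m\<bar> div int M))" for x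
  have t1: "lnorm (t x) \<le> lnorm x div M" for x
    unfolding lnorm_le_iff
  proof
    fix m
    have "\<bar>t x $ m\<bar> \<le> \<bar>x $ m\<bar> div int M"
      using M by (simp add: t_def abs_mult sgn_if pos_imp_zdiv_nonneg_iff)
    also have "\<dots> \<le> int (lnorm x) div int M"
      using M lnorm_nth_le by (intro zdiv_mono1) auto
    finally show "\<bar>t x $ m\<bar> \<le> int (lnorm x div M)" by (simp add: zdiv_int)
  qed
  have t2: "lnorm (x - dil M (t x)) \<le> M - 1" for x
    unfolding lnorm_le_iff
  proof
    fix m
    let ?y = "int M * (\<bar>x $ m\<bar> div int M)"
    have "?y + \<bar>x $ m\<bar> mod int M = \<bar>x $ m\<bar>" by (rule mult_div_mod_eq)
    moreover have "0 \<le> \<bar>x $ m\<bar> mod int M" "\<bar>x $ m\<bar> mod int M < int M" using M by auto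
    ultimately have "0 \<le> \<bar>x $ m\<bar> - ?y" "\<bar>x $ m\<bar> - ?y \<le> int (M - 1)"
      using M by linarith+
    moreover have "(x - dil M (t x)) $ m = sgn (x $ m) * (\<bar>x $ m\<bar> - ?y)"
      by (simp add: dil_def t_def right_diff_distrib sgn_mult_abs)
    ultimately show "\<bar>(x - dil M (t x)) $ m\<bar> \<le> int (M - 1)"
      by (simp only: abs_mult) (simp add: abs_sgn_eq)
  qed
  have "(\<Sum>k\<in>F. u (lnorm k div M)) \<le> (\<Sum>k\<in>F. u (lnorm (t k)))"
    by (intro sum_mono u_mono t1)
  also have "\<dots> = (\<Sum>p\<in>t ` F. \<Sum>k\<in>{k\<in>F. t k = p}. u (lnorm (t k)))"
    using F by (intro sum.image_gen)
  also have "\<dots> = (\<Sum>p\<in>t ` F. real (card {k\<in>F. t k = p}) * u (lnorm p))"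
    by (intro sum.cong refl) auto
  also have "\<dots> \<le> (\<Sum>p\<in>t ` F. real ((2 * M) ^ CARD('d)) * u (lnorm p))"
  proof (intro sum_mono mult_right_mono u_nonneg)
    fix p
    have "card {k\<in>F. t k = p} \<le> card {x. lnorm (x - dil M p) \<le> M - 1}"
      using t2 by (intro card_mono finite_ball) auto
    also have "\<dots> \<le> (2 * M) ^ CARD('d)" unfolding card_ball using M by (intro power_mono) auto
    finally show "real (card {k\<in>F. t k = p}) \<le> real ((2 * M) ^ CARD('d))" unfolding of_nat_le_iff .
  qed
  also have "\<dots> = real ((2 * M) ^ CARD('d)) * (\<Sum>p\<in>t ` F. u (lnorm p))"
    by (simp add: sum_distrib_left)
  also have "\<dots> \<le> real ((2 * M) ^ CARD('d)) * S"
    using u F by (intro mult_left_mono) (auto simp: radial_kernel_def)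
  finally show "(\<Sum>k\<in>F. u (lnorm k div M)) \<le> real ((2 * M) ^ CARD('d)) * S" .
qed

text \<open>All points of the cell \<open>p\<close> have norm at most
  \<open>N * (lnorm p + 1)\<close>, so the \<open>N ^ CARD('d)\<close> equal values are dominated by
  those of \<open>u\<close> on the cell, and the cells are disjoint. The mass does not grow with
  \<open>N\<close>, which is what permits choosing \<open>N\<close> late.\<close>

lemma radial_kernel_block:
  assumes u: "radial_kernel TYPE('d::finite) u S" and N: "1 \<le> N"
  shows "radial_kernel TYPE('d) (\<lambda>r. real (N ^ CARD('d)) * u (N * (r + 1))) S"
  unfolding radial_kernel_def
proof (intro conjI allI impI)
  note u_mono = radial_kernelD(1)[OF u] and u_nonneg = radial_kernelD(2)[OF u]
  show "antimono (\<lambda>r. real (N ^ CARD('d)) * u (N * (r + 1)))"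
    unfolding antimono_def by (auto intro!: u_mono mult_left_mono)
  show "0 \<le> real (N ^ CARD('d)) * u (N * (n + 1))" for n using u_nonneg by auto
  fix F :: "(int ^ 'd) set" assume F: "finite F"
  have "(\<Sum>p\<in>F. real (N ^ CARD('d)) * u (N * (lnorm p + 1))) =
     (\<Sum>p\<in>F. \<Sum>k\<in>cube (dil N p) N. u (N * (lnorm p + 1)))"
    by (simp add: card_cube)
  also have "\<dots> \<le> (\<Sum>p\<in>F. \<Sum>k\<in>cube (dil N p) N. u (lnorm k))"
  proof (intro sum_mono u_mono)
    fix p k :: "int ^ 'd" assume "k \<in> cube (dil N p) N"
    then have "quot N k = p" by (simp add: mem_cube_dil_iff[OF N])
    moreover have "quot N (0 :: int ^ 'd) = 0" by (simp add: quot_def vec_eq_iff)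
    ultimately show "lnorm k \<le> N * (lnorm p + 1)"
      using lnorm_le_quot[OF N, of k 0] by simp
  qed
  also have "\<dots> = (\<Sum>k\<in>(\<Union>p\<in>F. cube (dil N p) N). u (lnorm k))"
    using F by (intro sum.UNION_disjoint[symmetric]) (auto simp: mem_cube_dil_iff[OF N])
  also have "\<dots> \<le> S" using u F by (simp add: radial_kernel_def)
  finally show "(\<Sum>p\<in>F. real (N ^ CARD('d)) * u (N * (lnorm p + 1))) \<le> S" .
qed

lemma radial_kernel_tendsto_0:
  assumes u: "radial_kernel TYPE('d::finite) u S"
  shows "u \<longlonglongrightarrow> 0"
proof -
  note u_mono = radial_kernelD(1)[OF u] and u_nonneg = radial_kernelD(2)[OF u]
  have bd: "u m \<le> S / real (Suc m)" for m
  proof -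
    have "Suc m \<le> (2 * m + 1) ^ 1" by simp
    also have "\<dots> \<le> (2 * m + 1) ^ CARD('d)" by (intro power_increasing) (auto simp: Suc_le_eq)
    finally have "real (Suc m) * u m \<le> real ((2 * m + 1) ^ CARD('d)) * u m"
      using u_nonneg by (intro mult_right_mono) (simp_all only: of_nat_le_iff)
    also have "\<dots> = (\<Sum>k | lnorm (k - 0 :: int ^ 'd) \<le> m. u m)" by (simp only: sum_constant card_ball)
    also have "\<dots> \<le> (\<Sum>k | lnorm (k - 0 :: int ^ 'd) \<le> m. u (lnorm k))"
      by (intro sum_mono u_mono) auto
    also have "\<dots> \<le> S"
      using u finite_ball[of "0 :: int ^ 'd" m] by (simp add: radial_kernel_def)
    finally show ?thesis by (simp add: field_simps)
  qed
  have "(\<lambda>m. S * inverse (real (Suc m))) \<longlonglongrightarrow> S * 0"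
    by (intro tendsto_mult_left LIMSEQ_inverse_real_of_nat)
  then have "(\<lambda>m. S / real (Suc m)) \<longlonglongrightarrow> 0" by (simp add: divide_inverse)
  then show ?thesis
    by (rule tendsto_sandwich[rotated 2, OF tendsto_const])
      (intro always_eventually allI u_nonneg bd)+
qed

text \<open>Freezing the profile below \<open>m\<close>, instead of setting it to zero there, keeps
  it decreasing. Outside a finite set that nearly exhausts the total mass little is left, and on
  that set the values are at most \<open>u m\<close>, which tends to 0.\<close>

lemma radial_kernel_tail:
  assumes u: "radial_kernel TYPE('d::finite) u S" and e: "0 < e"
  obtains m where "1 \<le> m" "radial_kernel TYPE('d) (\<lambda>r. u (max r m)) e"
proof -
  note u_mono = radial_kernelD(1)[OF u] and u_nonneg = radial_kernelD(2)[OF u]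
  define X where "X = (\<lambda>F :: (int ^ 'd) set. \<Sum>k\<in>F. u (lnorm k)) ` {F. finite F}"
  have bdd: "bdd_above X" using u by (auto simp: X_def radial_kernel_def bdd_above_def)
  have "Sup X - e / 2 < Sup X" using e by simp
  moreover have "X \<noteq> {}" by (auto simp: X_def)
  ultimately obtain y where "y \<in> X" "Sup X - e / 2 < y" using less_cSup_iff[OF _ bdd] by blast
  then obtain F where F: "finite F" "Sup X - e / 2 < (\<Sum>k\<in>F. u (lnorm (k :: int ^ 'd)))"
    by (auto simp: X_def)
  have "(\<lambda>m. real (card F) * u m) \<longlonglongrightarrow> real (card F) * 0"
    by (intro tendsto_mult_left radial_kernel_tendsto_0[OF u])
  then have "eventually (\<lambda>m. real (card F) * u m < e / 2) sequentially"
    using e by (intro order_tendstoD(2)) auto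
  then have "eventually (\<lambda>m. real (card F) * u m < e / 2 \<and> 1 \<le> m) sequentially"
    using eventually_ge_at_top[of 1] by eventually_elim auto
  then obtain m where m: "real (card F) * u m < e / 2" "1 \<le> m"
    by (auto simp: eventually_sequentially)
  have "radial_kernel TYPE('d) (\<lambda>r. u (max r m)) e"
    unfolding radial_kernel_def
  proof (intro conjI allI impI)
    show "antimono (\<lambda>r. u (max r m))" unfolding antimono_def by (auto intro!: u_mono)
    show "0 \<le> u (max n m)" for n by (rule u_nonneg)
    fix G :: "(int ^ 'd) set" assume G: "finite G"
    have "(\<Sum>k\<in>G. u (max (lnorm k) m)) = (\<Sum>k\<in>G \<inter> F. u (max (lnorm k) m)) + (\<Sum>k\<in>G - F. u (max (lnorm k) m))"
      using G by (metis sum.Int_Diff)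
    also have "(\<Sum>k\<in>G \<inter> F. u (max (lnorm k) m)) \<le> (\<Sum>k\<in>F. u (max (lnorm k) m))"
      using F u_nonneg by (intro sum_mono2) auto
    also have "\<dots> \<le> (\<Sum>k\<in>F. u m)" by (intro sum_mono u_mono) auto
    also have "\<dots> < e / 2" using m by simp
    also have "(\<Sum>k\<in>G - F. u (max (lnorm k) m)) \<le> (\<Sum>k\<in>G - F. u (lnorm k))"
      by (intro sum_mono u_mono) auto
    also have "\<dots> = (\<Sum>k\<in>G \<union> F. u (lnorm k)) - (\<Sum>k\<in>F. u (lnorm k))"
      using F G by (subst sum_Un) (auto simp: sum_diff1 sum.Int_Diff[of G _ F])
    also have "(\<Sum>k\<in>G \<union> F. u (lnorm k)) \<le> Sup X"
      using F G by (intro cSup_upper bdd) (auto simp: X_def)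
    finally show "(\<Sum>k\<in>G. u (max (lnorm k) m)) \<le> e" using F by linarith
  qed
  then show thesis using m that by blast
qed

text \<open>\<open>W(r) = \<Sum>\<^sub>k (1/D)^k V(r/2^k)\<close> satisfies \<open>W(r/2) \<le> D W(r)\<close> and dominates \<open>V\<close>. In \<open>W * V\<close> one of
  the two factors is always taken at at least half of the distance, so a small mass of \<open>V\<close>
  makes \<open>W * V \<le> W/2\<close>.\<close>

lemma radial_kernel_supersolution:
  assumes V: "radial_kernel TYPE('d::finite) V S" and V0: "0 < V 0"
    and S: "S \<le> 1 / 4 ^ (CARD('d) + 2)"
  obtains W S' where "radial_kernel TYPE('d) W S'" "0 < W 0"
    "\<And>F (a :: int ^ 'd) c. finite F \<Longrightarrow>
       (\<Sum>b\<in>F. W (lnorm (a - b)) * V (lnorm (b - c))) \<le> W (lnorm (a - c)) / 2"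
proof -
  note V_mono = radial_kernelD(1)[OF V] and V_nonneg = radial_kernelD(2)[OF V]
    and S0 = radial_kernelD(5)[OF V]
  \<comment> \<open>Stretching by \<open>2 ^ k\<close> multiplies the mass by at most
    \<open>(2 * 2 ^ k) ^ CARD('d)\<close>. The extra power of 2 in \<open>D\<close> leaves a
    geometric series with ratio 1/2.\<close>
  define D where "D = (2 :: real) ^ (CARD('d) + 1)"
  define W where "W r = (\<Sum>k. (1 / D) ^ k * V (r div 2 ^ k))" for r
  have D: "D > 1" unfolding D_def by (intro one_less_power) auto
  have sm: "summable (\<lambda>k. (1 / D) ^ k * V (r div 2 ^ k))" for r
  proof (rule summable_comparison_test')
    show "summable (\<lambda>k. (1 / D) ^ k * V 0)"
      using D by (intro summable_mult2 summable_geometric) auto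
    show "norm ((1 / D) ^ k * V (r div 2 ^ k)) \<le> (1 / D) ^ k * V 0" for k
      using D V_nonneg V_mono[of 0] by (auto intro!: mult_left_mono divide_right_mono)
  qed
  have W_nonneg: "0 \<le> W r" for r
    unfolding W_def using D V_nonneg by (intro suminf_nonneg sm) auto
  have V_le_W: "V r \<le> W r" for r
  proof -
    have "(\<Sum>k\<in>{0}. (1 / D) ^ k * V (r div 2 ^ k)) \<le> W r"
      unfolding W_def using D V_nonneg by (intro sum_le_suminf sm) auto
    then show ?thesis by simp
  qed
  have W_mono: "W m \<le> W n" if "n \<le> m" for n m
    unfolding W_def using D that
    by (intro suminf_le sm mult_left_mono V_mono div_le_mono) auto
  have W_half: "W (r div 2) \<le> D * W r" for r
  proof -
    have "W r = (\<Sum>k. (1 / D) ^ Suc k * V (r div 2 ^ Suc k)) + V r"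
      unfolding W_def using suminf_split_head[OF sm, of r] by simp
    also have "(\<Sum>k. (1 / D) ^ Suc k * V (r div 2 ^ Suc k)) = (\<Sum>k. (1 / D) * ((1 / D) ^ k * V (r div 2 div 2 ^ k)))"
      by (simp add: div_mult2_eq)
    also have "\<dots> = (1 / D) * W (r div 2)" unfolding W_def by (intro suminf_mult sm)
    finally have "(1 / D) * W (r div 2) \<le> W r" using V_nonneg[of r] by simp
    then show ?thesis using D by (simp add: field_simps)
  qed
  have W: "radial_kernel TYPE('d) W (D * S)"
    unfolding radial_kernel_def
  proof (intro conjI allI impI)
    show "antimono W" using W_mono by (simp add: antimono_def)
    show "0 \<le> W n" for n by (rule W_nonneg)
    fix F :: "(int ^ 'd) set" assume F: "finite F"
    have gs: "(\<lambda>k. (1 / 2) ^ k :: real) sums 2"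
      using geometric_sums[of "1 / 2 :: real"] by simp
    have "(\<Sum>x\<in>F. W (lnorm x)) = (\<Sum>k. \<Sum>x\<in>F. (1 / D) ^ k * V (lnorm x div 2 ^ k))"
      unfolding W_def using sm by (intro suminf_sum[symmetric])
    also have "\<dots> \<le> (\<Sum>k. (1 / 2) ^ k * (2 ^ CARD('d) * S))"
    proof (intro suminf_le summable_sum sm summable_mult2 sums_summable[OF gs])
      fix k
      have "(\<Sum>x\<in>F. (1 / D) ^ k * V (lnorm x div 2 ^ k)) = (1 / D) ^ k * (\<Sum>x\<in>F. V (lnorm x div 2 ^ k))"
        by (simp add: sum_distrib_left)
      also have "\<dots> \<le> (1 / D) ^ k * (real ((2 * 2 ^ k) ^ CARD('d)) * S)"
        using D F radial_kernel_div[OF V, of "2 ^ k"]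
        by (intro mult_left_mono) (auto simp: radial_kernel_def)
      also have "\<dots> = (1 / 2) ^ k * (2 ^ CARD('d) * S)"
        by (simp add: D_def power_mult_distrib power_divide flip: power_mult)
          (simp add: power_add power_mult mult.commute)
      finally show "(\<Sum>x\<in>F. (1 / D) ^ k * V (lnorm x div 2 ^ k)) \<le> (1 / 2) ^ k * (2 ^ CARD('d) * S)" .
    qed
    also have "\<dots> = 2 * (2 ^ CARD('d) * S)"
      using sums_mult2[OF gs] by (rule sums_unique[symmetric])
    finally show "(\<Sum>x\<in>F. W (lnorm x)) \<le> D * S" by (simp add: D_def)
  qed
  show thesis
  proof (rule that[OF W])
    show "0 < W 0" using V_le_W[of 0] V0 by simp
    fix F :: "(int ^ 'd) set" and a c :: "int ^ 'd" assume F: "finite F"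
    define r where "r = lnorm (a - c) div 2"
    have "W (lnorm (a - b)) * V (lnorm (b - c)) \<le> W r * V (lnorm (b - c)) + W (lnorm (a - b)) * V r" for b
    proof (cases "r \<le> lnorm (a - b)")
      case True
      then have "W (lnorm (a - b)) * V (lnorm (b - c)) \<le> W r * V (lnorm (b - c))"
        using V_nonneg by (intro mult_right_mono W_mono)
      then show ?thesis using W_nonneg V_nonneg by (simp add: add_increasing2)
    next
      case False
      then have "r \<le> lnorm (b - c)" using lnorm_triangle3[of a c b] by (simp add: r_def)
      then have "W (lnorm (a - b)) * V (lnorm (b - c)) \<le> W (lnorm (a - b)) * V r"
        using W_nonneg by (intro mult_left_mono V_mono)
      then show ?thesis using W_nonneg V_nonneg by (simp add: add_increasing)
    qed
    then have "(\<Sum>b\<in>F. W (lnorm (a - b)) * V (lnorm (b - c)))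
      \<le> (\<Sum>b\<in>F. W r * V (lnorm (b - c)) + W (lnorm (a - b)) * V r)" by (intro sum_mono)
    also have "\<dots> = W r * (\<Sum>b\<in>F. V (lnorm (b - c))) + (\<Sum>b\<in>F. W (lnorm (a - b))) * V r"
      by (simp add: sum.distrib sum_distrib_left sum_distrib_right)
    also have "\<dots> \<le> W r * S + (D * S) * V r"
      using F W_nonneg V_nonneg
      by (intro add_mono mult_left_mono mult_right_mono radial_kernelD(4)[OF V] radial_kernelD(3)[OF W])
    also have "\<dots> \<le> W r * (D * S) + (D * S) * W r"
      using S0 D W_nonneg V_le_W by (intro add_mono mult_left_mono) (auto simp: mult_le_cancel_right1)
    also have "\<dots> = 2 * D * S * W r" by simp
    also have "\<dots> \<le> 2 * D * S * (D * W (lnorm (a - c)))"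
      using S0 D W_half by (intro mult_left_mono) (auto simp: r_def)
    also have "\<dots> = (2 * (D * D) * S) * W (lnorm (a - c))" by simp
    also have "\<dots> \<le> (1 / 2) * W (lnorm (a - c))"
    proof (intro mult_right_mono W_nonneg)
      \<comment> \<open>Here the threshold for \<open>S\<close> originates: \<open>D * D\<close> is
        \<open>4 ^ (CARD('d) + 1)\<close>.\<close>
      have "2 * (D * D) * S \<le> 2 * (D * D) * (1 / 4 ^ (CARD('d) + 2))"
        using S D by (intro mult_left_mono) auto
      also have "\<dots> = 1 / 2" unfolding D_def by (simp flip: power_mult_distrib)
      finally show "2 * (D * D) * S \<le> 1 / 2" .
    qed
    finally show "(\<Sum>b\<in>F. W (lnorm (a - b)) * V (lnorm (b - c))) \<le> W (lnorm (a - c)) / 2" by simp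
  qed
qed

section \<open>The Beurling class in terms of radial profiles\<close>

lemma beurling_classE:
  fixes A :: "'d::finite imatrix"
  assumes "A \<in> beurling_class"
  obtains h H where "radial_kernel TYPE('d) h H" "\<And>i j. cmod (A i j) \<le> h (lnorm (i - j))"
proof -
  \<comment> \<open>The supremum in the norm depends on \<open>k\<close> only through its norm, and
    the Beurling norm is the mass of \<open>U\<close>. Its term at \<open>k = 0\<close> bounds every
    \<open>U n\<close>, so real values can be used from here on.\<close>
  define U where "U n = (SUP (i, j) \<in> {(i, j). n \<le> lnorm (i - j)}. ennreal (cmod (A i j)))" for n
  have norm: "beurling_norm A = (\<Sum>\<^sub>\<infinity>k :: int ^ 'd. U (lnorm k))"
    by (simp add: beurling_norm_def U_def linf_norm_le_iff)
  have sum_le: "(\<Sum>k\<in>F. U (lnorm k)) \<le> beurling_norm A" if "finite F" for F :: "(int ^ 'd) set"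
    unfolding norm using that by (subst nonneg_infsum_complete) (auto intro!: SUP_upper)
  have fin: "beurling_norm A < top" using assms by (simp add: beurling_class_def)
  have U_mono: "U m \<le> U n" if "n \<le> m" for n m
    unfolding U_def using that by (intro SUP_subset_mono) auto
  have U_fin: "U n < top" for n
    using sum_le[of "{0}"] U_mono[of 0 n] fin by (simp add: order_le_less_trans)
  define h where "h n = enn2real (U n)" for n
  have h: "ennreal (h n) = U n" for n using U_fin by (simp add: h_def)
  show thesis
  proof (rule that)
    show "radial_kernel TYPE('d) h (enn2real (beurling_norm A))"
      unfolding radial_kernel_def
    proof (intro conjI allI impI)
      show "antimono h"
        unfolding antimono_def h_def using U_fin by (auto intro!: enn2real_mono U_mono)
      show "0 \<le> h n" for n by (simp add: h_def)
      fix F :: "(int ^ 'd) set" assume "finite F"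
      have "ennreal (\<Sum>k\<in>F. h (lnorm k)) = (\<Sum>k\<in>F. U (lnorm k))"
        by (simp add: h_def sum_ennreal[symmetric] U_fin)
      also have "\<dots> \<le> beurling_norm A" by (rule sum_le[OF \<open>finite F\<close>])
      also have "\<dots> = ennreal (enn2real (beurling_norm A))" using fin by simp
      finally show "(\<Sum>k\<in>F. h (lnorm k)) \<le> enn2real (beurling_norm A)" by simp
    qed
    show "cmod (A i j) \<le> h (lnorm (i - j))" for i j
    proof -
      have "ennreal (cmod (A i j)) \<le> U (lnorm (i - j))"
        unfolding U_def by (intro SUP_upper2[of "(i, j)"]) auto
      then have "ennreal (cmod (A i j)) \<le> ennreal (h (lnorm (i - j)))" by (simp add: h)
      then show ?thesis by (simp add: h_def)
    qed
  qed
qed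

lemma beurling_classI:
  fixes B :: "'d::finite imatrix"
  assumes u: "radial_kernel TYPE('d) u S" and B: "\<And>i j. cmod (B i j) \<le> u (lnorm (i - j))"
  shows "B \<in> beurling_class"
proof -
  have le: "(SUP (i, j) \<in> {(i, j). linf_norm k \<le> linf_norm (i - j)}. ennreal (cmod (B i j)))
      \<le> ennreal (u (lnorm k))" for k
  proof (rule SUP_least, clarify)
    fix i j :: "int ^ 'd" assume "linf_norm k \<le> linf_norm (i - j)"
    then have "u (lnorm (i - j)) \<le> u (lnorm k)"
      by (intro radial_kernelD(1)[OF u]) (simp add: linf_norm_le_iff)
    then show "ennreal (cmod (B i j)) \<le> ennreal (u (lnorm k))"
      using B[of i j] by (intro ennreal_leI) linarith
  qed
  have "beurling_norm B \<le> (\<Sum>\<^sub>\<infinity>k :: int ^ 'd. ennreal (u (lnorm k)))"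
    unfolding beurling_norm_def by (intro infsum_mono nonneg_summable_on_complete le zero_le)
  also have "\<dots> = (SUP F\<in>{F. finite F \<and> F \<subseteq> UNIV}. \<Sum>k\<in>F. ennreal (u (lnorm (k :: int ^ 'd))))"
    by (rule nonneg_infsum_complete) simp
  also have "\<dots> \<le> ennreal S"
    using u by (intro SUP_least) (auto simp: sum_ennreal radial_kernel_def intro!: ennreal_leI)
  also have "\<dots> < \<infinity>" by simp
  finally show ?thesis by (simp add: beurling_class_def)
qed

subsection \<open>Convolution on weighted spaces\<close>

text \<open>The hypothesis \<open>cube_ineq\<close> is the \<open>A\<^sub>q\<close> condition tested against arbitrary \<open>x \<ge> 0\<close>; in this
  form the dual weight \<open>w powr (-1/(q - 1))\<close> disappears and \<open>q = 1\<close> needs no separate treatment.\<close>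

locale muckenhoupt =
  fixes q K :: real and w :: "int ^ 'd::finite \<Rightarrow> real"
  assumes q_ge1: "1 \<le> q" and K_ge1: "1 \<le> K" and w_pos: "0 < w i"
    and cube_ineq: "1 \<le> N \<Longrightarrow> (\<And>i. 0 \<le> x i) \<Longrightarrow>
      (\<Sum>i\<in>cube a N. x i) powr q * (\<Sum>i\<in>cube a N. w i)
      \<le> K * real (N ^ CARD('d)) powr q * (\<Sum>i\<in>cube a N. x i powr q * w i)"
begin

lemma w_nonneg: "0 \<le> w i"
  using w_pos[of i] by simp

text \<open>This is \<open>cube_ineq\<close> on the large cube with the indicator of the small one
  as test function.\<close>

lemma doubling:
  assumes "1 \<le> N" "1 \<le> r" "cube a N \<subseteq> cube b (r * N)"
  shows "(\<Sum>i\<in>cube b (r * N). w i) \<le> K * real (r ^ CARD('d)) powr q * (\<Sum>i\<in>cube a N. w i)"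
proof -
  let ?x = "\<lambda>i. if i \<in> cube a N then 1 else 0 :: real"
  have "(\<Sum>i\<in>cube b (r * N). ?x i) powr q * (\<Sum>i\<in>cube b (r * N). w i)
      \<le> K * real ((r * N) ^ CARD('d)) powr q * (\<Sum>i\<in>cube b (r * N). ?x i powr q * w i)"
    using assms by (intro cube_ineq) auto
  also have "(\<Sum>i\<in>cube b (r * N). ?x i) = real (N ^ CARD('d))"
    using assms(3) by (simp add: sum.If_cases Int_absorb1 card_cube)
  also have "(\<Sum>i\<in>cube b (r * N). ?x i powr q * w i) = (\<Sum>i\<in>cube a N. w i)"
    using assms(3) by (intro sum.mono_neutral_cong_right) auto
  also have "real ((r * N) ^ CARD('d)) powr q = real (r ^ CARD('d)) powr q * real (N ^ CARD('d)) powr q"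
    by (simp add: power_mult_distrib powr_mult)
  finally have "real (N ^ CARD('d)) powr q * (\<Sum>i\<in>cube b (r * N). w i) \<le>
     real (N ^ CARD('d)) powr q * (K * real (r ^ CARD('d)) powr q * (\<Sum>i\<in>cube a N. w i))"
    by (simp add: mult_ac)
  moreover have "real (N ^ CARD('d)) powr q > 0" using assms(1) by simp
  ultimately show ?thesis by (simp only: mult_le_cancel_left_pos)
qed

text \<open>Cells of side \<open>n + 1\<close> replace balls of radius \<open>n\<close>: the ball
  around \<open>i\<close> lies in the block of \<open>3 ^ CARD('d)\<close> cells around the cell of
  \<open>i\<close>, and this block is a cube to which \<open>cube_ineq\<close> applies. Every
  \<open>j\<close> lies in at most \<open>3 ^ CARD('d)\<close> blocks.\<close>

lemma averaging_bound:
  assumes "finite I" "finite J" "\<And>j. 0 \<le> x j"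
  shows "(\<Sum>i\<in>I. w i * (\<Sum>j\<in>{j\<in>J. lnorm (i - j) \<le> n}. x j) powr q)
    \<le> real (3 ^ CARD('d)) * K * real ((3 * (n + 1)) ^ CARD('d)) powr q * (\<Sum>j\<in>J. x j powr q * w j)"
proof -
  define N where "N = n + 1"
  have N: "1 \<le> N" by (simp add: N_def)
  define R where "R p = {j. lnorm (quot N j - p) \<le> 1}" for p :: "int ^ 'd"
  have R: "R p = cube (dil N (p - (\<chi> m. 1))) (3 * N)" for p
    unfolding R_def using quot_near_eq_cube[OF N, of p 1] by simp
  have finR: "finite (R p)" for p unfolding R by simp
  define y where "y j = (if j \<in> J then x j else 0)" for j
  define Y where "Y p = (\<Sum>j\<in>R p. y j)" for p
  have Y0: "0 \<le> Y p" for p unfolding Y_def y_def using assms by (intro sum_nonneg) auto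
  define C where "C = K * real ((3 * N) ^ CARD('d)) powr q"
  have C0: "0 \<le> C" using K_ge1 by (simp add: C_def)
  have "(\<Sum>j\<in>{j\<in>J. lnorm (i - j) \<le> n}. x j) \<le> Y (quot N i)" for i
  proof -
    have "{j\<in>J. lnorm (i - j) \<le> n} \<subseteq> R (quot N i)"
    proof
      fix j assume "j \<in> {j\<in>J. lnorm (i - j) \<le> n}"
      then have "lnorm (j - i) \<le> n" by (simp add: lnorm_minus_commute)
      then have "N * lnorm (quot N j - quot N i) < N * 2"
        using lnorm_ge_quot[OF N, of j i] by (simp add: N_def)
      then have "lnorm (quot N j - quot N i) < 2" by (simp only: mult_less_cancel1)
      then show "j \<in> R (quot N i)" by (simp add: R_def)
    qed
    then have "(\<Sum>j\<in>{j\<in>J. lnorm (i - j) \<le> n}. y j) \<le> Y (quot N i)"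
      unfolding Y_def using finR assms by (intro sum_mono2) (auto simp: y_def)
    moreover have "(\<Sum>j\<in>{j\<in>J. lnorm (i - j) \<le> n}. y j) = (\<Sum>j\<in>{j\<in>J. lnorm (i - j) \<le> n}. x j)"
      by (intro sum.cong) (auto simp: y_def)
    ultimately show ?thesis by simp
  qed
  then have "(\<Sum>i\<in>I. w i * (\<Sum>j\<in>{j\<in>J. lnorm (i - j) \<le> n}. x j) powr q)
      \<le> (\<Sum>i\<in>I. w i * Y (quot N i) powr q)"
    using assms q_ge1 w_nonneg
    by (intro sum_mono mult_left_mono powr_mono2) (auto intro!: sum_nonneg)
  also have "\<dots> = (\<Sum>p\<in>quot N ` I. \<Sum>i\<in>{i\<in>I. quot N i = p}. w i * Y (quot N i) powr q)"
    using assms by (intro sum.image_gen) auto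
  also have "\<dots> = (\<Sum>p\<in>quot N ` I. Y p powr q * (\<Sum>i\<in>{i\<in>I. quot N i = p}. w i))"
    by (intro sum.cong refl) (auto simp: sum_distrib_left mult.commute)
  also have "\<dots> \<le> (\<Sum>p\<in>quot N ` I. C * (\<Sum>j\<in>R p. y j powr q * w j))"
  proof (intro sum_mono)
    fix p
    have "(\<Sum>i\<in>{i\<in>I. quot N i = p}. w i) \<le> (\<Sum>i\<in>R p. w i)"
      using w_nonneg finR by (intro sum_mono2) (auto simp: R_def)
    then have "Y p powr q * (\<Sum>i\<in>{i\<in>I. quot N i = p}. w i) \<le> Y p powr q * (\<Sum>i\<in>R p. w i)"
      by (intro mult_left_mono) auto
    also have "\<dots> \<le> C * (\<Sum>j\<in>R p. y j powr q * w j)"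
      unfolding Y_def C_def R using assms N by (intro cube_ineq) (auto simp: y_def)
    finally show "Y p powr q * (\<Sum>i\<in>{i\<in>I. quot N i = p}. w i) \<le> C * (\<Sum>j\<in>R p. y j powr q * w j)" .
  qed
  also have "\<dots> = C * (\<Sum>p\<in>quot N ` I. \<Sum>j\<in>R p. y j powr q * w j)"
    by (simp add: sum_distrib_left)
  also have "(\<Sum>p\<in>quot N ` I. \<Sum>j\<in>R p. y j powr q * w j)
     = (\<Sum>p\<in>quot N ` I. \<Sum>j\<in>{j\<in>J. lnorm (quot N j - p) \<le> 1}. x j powr q * w j)"
    using finR by (intro sum.cong[OF refl] sum.mono_neutral_cong_right) (auto simp: R_def y_def)
  also have "C * \<dots> \<le> C * (real ((2 * 1 + 1) ^ CARD('d)) * (\<Sum>j\<in>J. x j powr q * w j))"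
    using assms w_nonneg C0 by (intro mult_left_mono overlap_sum_le) auto
  finally show ?thesis by (simp add: C_def N_def mult_ac)
qed

text \<open>The first factor is the overlap of the blocks in \<open>averaging_bound\<close>; the
  last one compares a block of side \<open>3 * (n + 1)\<close> with the ball of radius
  \<open>n\<close>, of side \<open>2 * n + 1\<close>.\<close>

definition conv_const :: real where
  "conv_const = real (3 ^ CARD('d)) * K * real (3 ^ CARD('d)) powr q"

lemma conv_const_ge1: "1 \<le> conv_const"
proof -
  have "1 * 1 * 1 \<le> conv_const"
    unfolding conv_const_def using K_ge1 q_ge1
    by (intro mult_mono ge_one_powr_ge_zero) auto
  then show ?thesis by simp
qed

text \<open>Jensen's inequality for the layer-cake decomposition of \<open>u\<close> into indicators of balls reduces
  this to \<open>averaging_bound\<close>.\<close>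

lemma convolution_bound:
  assumes u: "radial_kernel TYPE('d) u S"
    and fin: "finite I" "finite J" and x0: "\<And>j. 0 \<le> x j"
  shows "(\<Sum>i\<in>I. w i * (\<Sum>j\<in>J. u (lnorm (i - j)) * x j) powr q)
    \<le> conv_const * S powr q * (\<Sum>j\<in>J. x j powr q * w j)"
proof -
  note u_mono = radial_kernelD(1)[OF u] and u_nonneg = radial_kernelD(2)[OF u]
    and S0 = radial_kernelD(5)[OF u]
  obtain R where R: "\<And>i j. i \<in> I \<Longrightarrow> j \<in> J \<Longrightarrow> lnorm (i - j) \<le> R"
  proof
    fix i j assume "i \<in> I" "j \<in> J"
    then show "lnorm (i - j) \<le> Max ((\<lambda>(i,j). lnorm (i - j)) ` (I \<times> J))"
      using fin by (intro Max_ge) auto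
  qed
  \<comment> \<open>Layers of \<open>u\<close> truncated at the largest occurring distance
    \<open>R\<close>. The top layer carries all of \<open>u R\<close>, so that the layers from
    \<open>r\<close> to \<open>R\<close> add up to \<open>u r\<close> exactly.\<close>
  define l where "l n = (if n < R then u n - u (Suc n) else u n)" for n
  have l0: "0 \<le> l n" for n using u_mono[of n "Suc n"] u_nonneg[of n] by (simp add: l_def)
  have layer: "(\<Sum>n\<in>{n. r \<le> n \<and> n \<le> R}. l n) = u r" if "r \<le> R" for r
    using that
  proof (induction rule: inc_induct)
    case base
    have "{n. R \<le> n \<and> n \<le> R} = {R}" by auto
    then show ?case by (simp add: l_def)
  next
    case (step r)
    have "{n. r \<le> n \<and> n \<le> R} = insert r {n. Suc r \<le> n \<and> n \<le> R}" using step by auto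
    moreover have "finite {n. Suc r \<le> n \<and> n \<le> R}" by simp
    ultimately show ?case using step by (simp add: l_def)
  qed
  define B where "B n = real ((2 * n + 1) ^ CARD('d))" for n
  have B0: "B n > 0" for n by (simp add: B_def)
  \<comment> \<open>The numbers \<open>l n * B n\<close> are the masses for Jensen's inequality.
    Their total is the sum of \<open>u\<close> over the ball of radius \<open>R\<close>.\<close>
  have lB: "(\<Sum>n\<le>R. l n * B n) \<le> S"
  proof -
    have "(\<Sum>n\<le>R. l n * B n) = (\<Sum>n\<le>R. \<Sum>k\<in>{k\<in>{k::int^'d. lnorm k \<le> R}. lnorm k \<le> n}. l n)"
    proof (intro sum.cong refl)
      fix n assume "n \<in> {..R}"
      then have "{k\<in>{k::int^'d. lnorm k \<le> R}. lnorm k \<le> n} = {k::int^'d. lnorm (k - 0) \<le> n}" by auto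
      then show "l n * B n = (\<Sum>k\<in>{k\<in>{k::int^'d. lnorm k \<le> R}. lnorm k \<le> n}. l n)"
        by (simp only: sum_constant card_ball B_def mult.commute)
    qed
    also have "\<dots> = (\<Sum>k | lnorm (k::int^'d) \<le> R. \<Sum>n\<in>{n\<in>{..R}. lnorm k \<le> n}. l n)"
      using finite_ball[of 0 R] by (intro sum.swap_restrict) auto
    also have "\<dots> = (\<Sum>k | lnorm (k::int^'d) \<le> R. u (lnorm k))"
      by (intro sum.cong refl) (subst layer[symmetric], auto intro: sum.cong)
    also have "\<dots> \<le> S" using radial_kernelD(4)[OF u, of _ 0] finite_ball[of 0 R] by simp
    finally show ?thesis .
  qed
  define T where "T n i = (\<Sum>j\<in>{j\<in>J. lnorm (i - j) \<le> n}. x j)" for n i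
  have T0: "0 \<le> T n i" for n i unfolding T_def using x0 by (intro sum_nonneg) auto
  have eq: "(\<Sum>j\<in>J. u (lnorm (i - j)) * x j) = (\<Sum>n\<le>R. l n * B n * (T n i / B n))" if "i \<in> I" for i
  proof -
    have "(\<Sum>j\<in>J. u (lnorm (i - j)) * x j) = (\<Sum>j\<in>J. \<Sum>n\<in>{n\<in>{..R}. lnorm (i - j) \<le> n}. l n * x j)"
      using R[OF that]
      by (intro sum.cong refl) (subst layer[symmetric], auto simp: sum_distrib_right intro: sum.cong)
    also have "\<dots> = (\<Sum>n\<le>R. \<Sum>j\<in>{j\<in>J. lnorm (i - j) \<le> n}. l n * x j)"
      using fin by (intro sum.swap_restrict) auto
    also have "\<dots> = (\<Sum>n\<le>R. l n * T n i)" by (simp add: T_def sum_distrib_left)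
    also have "\<dots> = (\<Sum>n\<le>R. l n * B n * (T n i / B n))"
      using B0 by (intro sum.cong refl) (simp add: less_imp_neq[OF B0, symmetric])
    finally show ?thesis .
  qed
  have pt: "(\<Sum>j\<in>J. u (lnorm (i - j)) * x j) powr q
      \<le> S powr (q - 1) * (\<Sum>n\<le>R. l n * B n * (T n i / B n) powr q)" if "i \<in> I" for i
  proof -
    have "(\<Sum>n\<le>R. l n * B n * (T n i / B n)) powr q
       \<le> (\<Sum>n\<le>R. l n * B n) powr (q - 1) * (\<Sum>n\<le>R. l n * B n * (T n i / B n) powr q)"
      using l0 B0 T0 q_ge1 by (intro sum_powr_Jensen) (auto simp: less_imp_le)
    also have "\<dots> \<le> S powr (q - 1) * (\<Sum>n\<le>R. l n * B n * (T n i / B n) powr q)"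
      using l0 B0 T0 q_ge1 lB
      by (intro mult_right_mono powr_mono2 sum_nonneg) (auto simp: less_imp_le)
    finally show ?thesis using eq[OF that] by simp
  qed
  let ?X = "\<Sum>j\<in>J. x j powr q * w j"
  have X0: "0 \<le> ?X" using w_nonneg by (intro sum_nonneg) auto
  have avg: "(\<Sum>i\<in>I. w i * (T n i / B n) powr q) \<le> conv_const * ?X" for n
  proof -
    have "(\<Sum>i\<in>I. w i * (T n i / B n) powr q) = (\<Sum>i\<in>I. w i * T n i powr q) / B n powr q"
      using T0 B0 by (simp add: powr_divide less_imp_le sum_divide_distrib)
    also have "\<dots> \<le> (real (3 ^ CARD('d)) * K * real ((3 * (n + 1)) ^ CARD('d)) powr q * ?X) / B n powr q"
      unfolding T_def by (intro divide_right_mono averaging_bound fin x0) auto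
    also have "\<dots> \<le> (real (3 ^ CARD('d)) * K * (real (3 ^ CARD('d)) * B n) powr q * ?X) / B n powr q"
    proof (intro divide_right_mono mult_right_mono mult_left_mono powr_mono2)
      have "(3 * (n + 1)) ^ CARD('d) \<le> (3 * (2 * n + 1)) ^ CARD('d)" by (intro power_mono) auto
      then show "real ((3 * (n + 1)) ^ CARD('d)) \<le> real (3 ^ CARD('d)) * B n"
        unfolding B_def by (simp only: power_mult_distrib flip: of_nat_mult of_nat_le_iff)
    qed (use X0 K_ge1 q_ge1 in auto)
    also have "\<dots> = conv_const * ?X"
      using B0[of n] by (simp add: powr_mult conv_const_def)
    finally show ?thesis .
  qed
  have "(\<Sum>i\<in>I. w i * (\<Sum>j\<in>J. u (lnorm (i - j)) * x j) powr q)
     \<le> (\<Sum>i\<in>I. w i * (S powr (q - 1) * (\<Sum>n\<le>R. l n * B n * (T n i / B n) powr q)))"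
    by (intro sum_mono mult_left_mono pt w_nonneg)
  also have "\<dots> = S powr (q - 1) * (\<Sum>i\<in>I. \<Sum>n\<le>R. l n * B n * (w i * (T n i / B n) powr q))"
    by (simp add: sum_distrib_left mult_ac)
  also have "(\<Sum>i\<in>I. \<Sum>n\<le>R. l n * B n * (w i * (T n i / B n) powr q))
     = (\<Sum>n\<le>R. \<Sum>i\<in>I. l n * B n * (w i * (T n i / B n) powr q))" by (rule sum.swap)
  also have "\<dots> = (\<Sum>n\<le>R. l n * B n * (\<Sum>i\<in>I. w i * (T n i / B n) powr q))"
    by (simp only: sum_distrib_left)
  also have "S powr (q - 1) * \<dots> \<le> S powr (q - 1) * (\<Sum>n\<le>R. l n * B n * (conv_const * ?X))"
    using l0 B0 by (intro mult_left_mono sum_mono avg) (auto simp: less_imp_le)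
  also have "\<dots> = S powr (q - 1) * ((\<Sum>n\<le>R. l n * B n) * (conv_const * ?X))"
    by (simp only: sum_distrib_right)
  also have "\<dots> \<le> S powr (q - 1) * (S * (conv_const * ?X))"
    using X0 conv_const_ge1 lB by (intro mult_left_mono mult_right_mono) auto
  also have "\<dots> = (S * S powr (q - 1)) * (conv_const * ?X)" by (simp add: mult_ac)
  also have "S * S powr (q - 1) = S powr q" using S0 by (simp add: powr_mult_base)
  finally show ?thesis by (simp add: mult_ac)
qed

end

text \<open>For \<open>q = 1\<close> every \<open>w j\<close> dominates the infimum over the cube,
  up to the constant hence the average. For \<open>q > 1\<close> the inequality is Hoelder's,
  followed by the weight condition.\<close>

lemma discrete_weight_muckenhoupt:
  fixes w :: "int ^ 'd::finite \<Rightarrow> real"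
  assumes q: "1 \<le> q" and w: "discrete_weight q w"
  obtains K where "muckenhoupt q K w"
proof -
  have w_pos: "0 < w i" for i using w by (simp add: discrete_weight_def)
  have w0: "0 \<le> w i" for i using w_pos[of i] by simp
  have "\<exists>C. \<forall>a. \<forall>N\<ge>1. \<forall>x. (\<forall>i. 0 \<le> x i) \<longrightarrow>
      (\<Sum>i\<in>cube a N. x i) powr q * (\<Sum>i\<in>cube a N. w i)
      \<le> C * real (N ^ CARD('d)) powr q * (\<Sum>i\<in>cube a N. x i powr q * w i)"
  proof (cases "q = 1")
    case True
    then obtain C where C: "\<And>a N. N \<ge> 1 \<Longrightarrow> cube_avg a N w \<le> C * (INF i\<in>cube a N. w i)"
      using w by (auto simp: discrete_weight_def)
    show ?thesis
    proof (intro exI[of _ "max C 0"] allI impI)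
      fix a :: "int ^ 'd" and N :: nat and x :: "int ^ 'd \<Rightarrow> real"
      assume N: "1 \<le> N" and x: "\<forall>i. 0 \<le> x i"
      let ?Q = "cube a N"
      have "x j * (\<Sum>i\<in>?Q. w i) \<le> max C 0 * real (N ^ CARD('d)) * (x j * w j)" if "j \<in> ?Q" for j
      proof -
        have inf: "(INF i\<in>?Q. w i) \<le> w j" "0 \<le> (INF i\<in>?Q. w i)"
          using that w0 by (auto intro!: cINF_lower cINF_greatest bdd_below_finite)
        have "cube_avg a N w \<le> C * (INF i\<in>?Q. w i)" using C N by blast
        also have "\<dots> \<le> max C 0 * w j" using inf by (intro mult_mono) auto
        finally have "(\<Sum>i\<in>?Q. w i) \<le> max C 0 * w j * real N ^ CARD('d)"
          using N by (simp add: cube_avg_def divide_le_eq)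
        then have "x j * (\<Sum>i\<in>?Q. w i) \<le> x j * (max C 0 * w j * real N ^ CARD('d))"
          using x by (intro mult_left_mono) auto
        then show ?thesis by (simp add: mult_ac)
      qed
      then have "(\<Sum>j\<in>?Q. x j * (\<Sum>i\<in>?Q. w i)) \<le> (\<Sum>j\<in>?Q. max C 0 * real (N ^ CARD('d)) * (x j * w j))"
        by (intro sum_mono)
      then have "(\<Sum>j\<in>?Q. x j) * (\<Sum>i\<in>?Q. w i) \<le> max C 0 * real (N ^ CARD('d)) * (\<Sum>j\<in>?Q. x j * w j)"
        by (simp only: flip: sum_distrib_right sum_distrib_left)
      then show "(\<Sum>i\<in>?Q. x i) powr q * (\<Sum>i\<in>?Q. w i)
         \<le> max C 0 * real (N ^ CARD('d)) powr q * (\<Sum>i\<in>?Q. x i powr q * w i)"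
        using True x by (simp add: sum_nonneg)
    qed
  next
    case False
    with q have q1: "q > 1" by simp
    from False obtain C where C: "\<And>a N. N \<ge> 1 \<Longrightarrow>
        cube_avg a N w * cube_avg a N (\<lambda>i. w i powr (- 1 / (q - 1))) powr (q - 1) \<le> C"
      using w by (auto simp: discrete_weight_def)
    show ?thesis
    proof (intro exI[of _ C] allI impI)
      fix a :: "int ^ 'd" and N :: nat and x :: "int ^ 'd \<Rightarrow> real"
      assume N: "1 \<le> N" and x: "\<forall>i. 0 \<le> x i"
      let ?Q = "cube a N"
      \<comment> \<open>The dual weight. Jensen's inequality with masses \<open>s\<close> and values
        \<open>x / s\<close> is Hoelder's inequality, since \<open>s i powr (q - 1)\<close> is the
        reciprocal of \<open>w i\<close>.\<close>
      define s where "s i = w i powr (- 1 / (q - 1))" for i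
      have s: "s i > 0" for i using w_pos[of i] by (simp add: s_def)
      have s1: "s i powr (q - 1) * w i = 1" for i
        using w_pos[of i] q1 by (simp add: s_def powr_powr powr_neg_one del: powr_powr_swap)
      define M where "M = real (N ^ CARD('d))"
      have M: "M > 0" using N by (simp add: M_def)
      have "(\<Sum>i\<in>?Q. x i) powr q = (\<Sum>i\<in>?Q. s i * (x i / s i)) powr q"
        using s by (simp add: less_imp_neq[OF s, symmetric])
      also have "\<dots> \<le> (\<Sum>i\<in>?Q. s i) powr (q - 1) * (\<Sum>i\<in>?Q. s i * (x i / s i) powr q)"
        using s x q by (intro sum_powr_Jensen) (auto simp: less_imp_le)
      also have "(\<Sum>i\<in>?Q. s i * (x i / s i) powr q) = (\<Sum>i\<in>?Q. x i powr q * w i)"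
      proof (intro sum.cong refl)
        fix i
        have "s i * (x i / s i) powr q = x i powr q * (s i / s i powr q)"
          using s[of i] x by (simp add: powr_divide less_imp_le)
        also have "s i / s i powr q = 1 / s i powr (q - 1)"
          using s[of i] by (simp add: powr_diff)
        also have "\<dots> = w i" using s1[of i] s[of i]
          by (simp add: divide_simps mult.commute split: if_splits)
        finally show "s i * (x i / s i) powr q = x i powr q * w i" .
      qed
      finally have "(\<Sum>i\<in>?Q. x i) powr q * (\<Sum>i\<in>?Q. w i)
         \<le> (\<Sum>i\<in>?Q. s i) powr (q - 1) * (\<Sum>i\<in>?Q. x i powr q * w i) * (\<Sum>i\<in>?Q. w i)"
        using w0 by (intro mult_right_mono sum_nonneg) auto
      also have "\<dots> = ((\<Sum>i\<in>?Q. w i) * (\<Sum>i\<in>?Q. s i) powr (q - 1)) * (\<Sum>i\<in>?Q. x i powr q * w i)"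
        by (simp add: mult_ac)
      also have "\<dots> \<le> (C * M powr q) * (\<Sum>i\<in>?Q. x i powr q * w i)"
      proof (intro mult_right_mono sum_nonneg)
        have "cube_avg a N w * cube_avg a N s powr (q - 1) \<le> C"
          using C[OF N] unfolding s_def by simp
        then have "(\<Sum>i\<in>?Q. w i) / M * ((\<Sum>i\<in>?Q. s i) / M) powr (q - 1) \<le> C"
          by (simp add: cube_avg_def M_def)
        then have "(\<Sum>i\<in>?Q. w i) * (\<Sum>i\<in>?Q. s i) powr (q - 1) / (M * M powr (q - 1)) \<le> C"
          using s M by (simp add: powr_divide sum_nonneg less_imp_le)
        moreover have "M * M powr (q - 1) = M powr q" using M by (simp add: powr_mult_base)
        ultimately show "(\<Sum>i\<in>?Q. w i) * (\<Sum>i\<in>?Q. s i) powr (q - 1) \<le> C * M powr q"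
          using M by (simp add: divide_le_eq)
      qed (use w0 in auto)
      finally show "(\<Sum>i\<in>?Q. x i) powr q * (\<Sum>i\<in>?Q. w i)
         \<le> C * real (N ^ CARD('d)) powr q * (\<Sum>i\<in>?Q. x i powr q * w i)"
        by (simp add: M_def)
    qed
  qed
  then obtain C where C: "\<And>a N x. 1 \<le> N \<Longrightarrow> (\<And>i. 0 \<le> x i) \<Longrightarrow>
      (\<Sum>i\<in>cube a N. x i) powr q * (\<Sum>i\<in>cube a N. w i)
      \<le> C * real (N ^ CARD('d)) powr q * (\<Sum>i\<in>cube a N. x i powr q * w i)"
    by blast
  have "muckenhoupt q (max C 1) w"
  proof
    fix N :: nat and x :: "int ^ 'd \<Rightarrow> real" and a :: "int ^ 'd"
    assume N: "1 \<le> N" and x: "\<And>i. 0 \<le> x i"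
    have "(\<Sum>i\<in>cube a N. x i) powr q * (\<Sum>i\<in>cube a N. w i)
      \<le> C * real (N ^ CARD('d)) powr q * (\<Sum>i\<in>cube a N. x i powr q * w i)" by (rule C[OF N x])
    also have "\<dots> \<le> max C 1 * real (N ^ CARD('d)) powr q * (\<Sum>i\<in>cube a N. x i powr q * w i)"
      using w0 by (intro mult_right_mono sum_nonneg) auto
    finally show "(\<Sum>i\<in>cube a N. x i) powr q * (\<Sum>i\<in>cube a N. w i)
      \<le> max C 1 * real (N ^ CARD('d)) powr q * (\<Sum>i\<in>cube a N. x i powr q * w i)" .
  qed (use q w_pos in auto)
  then show thesis by (rule that)
qed

subsection \<open>Localisation\<close>

context muckenhoupt
begin

text \<open>The l^q norm of \<open>x\<close> on cell \<open>n\<close> with respect to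
  \<open>w\<close> divided by its total mass on that cell. Thanks to the normalisation, values on
  different cells can be compared without mentioning \<open>w\<close>. The set \<open>J\<close> is
  the support to which \<open>x\<close> is restricted.\<close>

definition local_avg :: "nat \<Rightarrow> (int ^ 'd) set \<Rightarrow> (int ^ 'd \<Rightarrow> real) \<Rightarrow> int ^ 'd \<Rightarrow> real" where
  "local_avg N J x n =
     ((\<Sum>j\<in>{j\<in>J. quot N j = n}. x j powr q * w j) / (\<Sum>j\<in>cube (dil N n) N. w j)) powr (1 / q)"

lemma local_avg_nonneg [simp]: "0 \<le> local_avg N J x n"
  by (simp add: local_avg_def)

lemma cube_weight_pos: "1 \<le> N \<Longrightarrow> 0 < (\<Sum>j\<in>cube a N. w j)"
  by (intro sum_pos w_pos finite_cube) (metis card.empty card_cube not_one_le_zero power_not_zero)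

lemma local_avg_powr:
  assumes "1 \<le> N"
  shows "local_avg N J x n powr q * (\<Sum>j\<in>cube (dil N n) N. w j)
    = (\<Sum>j\<in>{j\<in>J. quot N j = n}. x j powr q * w j)"
proof -
  have "0 \<le> (\<Sum>j\<in>{j\<in>J. quot N j = n}. x j powr q * w j)"
    using w_nonneg by (intro sum_nonneg) auto
  then show ?thesis
    using cube_weight_pos[OF assms, of "dil N n"] q_ge1 by (simp add: local_avg_def powr_powr)
qed

text \<open>\<open>cube_ineq\<close> on a single cell, whose weight then cancels. This removes the
  weight from interactions between distant cells, where weights are not comparable with a fixed
  constant. As \<open>K \<le> K powr q\<close>, no root of \<open>K\<close> is needed.\<close>

lemma cell_sum_le_local_avg:
  assumes N: "1 \<le> N" and J: "finite J" and x: "\<And>j. 0 \<le> x j"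
  shows "(\<Sum>j\<in>{j\<in>J. quot N j = n}. x j) \<le> K * real (N ^ CARD('d)) * local_avg N J x n"
proof -
  let ?Q = "cube (dil N n) N"
  let ?W = "\<Sum>j\<in>?Q. w j"
  define y where "y j = (if j \<in> J then x j else 0)" for j
  have e1: "(\<Sum>j\<in>?Q. y j) = (\<Sum>j\<in>{j\<in>J. quot N j = n}. x j)"
    by (intro sum.mono_neutral_cong_right) (auto simp: y_def mem_cube_dil_iff[OF N])
  have e2: "(\<Sum>j\<in>?Q. y j powr q * w j) = (\<Sum>j\<in>{j\<in>J. quot N j = n}. x j powr q * w j)"
    by (intro sum.mono_neutral_cong_right) (auto simp: y_def mem_cube_dil_iff[OF N])
  have "(\<Sum>j\<in>?Q. y j) powr q * ?W \<le> K * real (N ^ CARD('d)) powr q * (\<Sum>j\<in>?Q. y j powr q * w j)"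
    using x by (intro cube_ineq N) (auto simp: y_def)
  also have "\<dots> = (K * real (N ^ CARD('d)) powr q * local_avg N J x n powr q) * ?W"
    unfolding e2 local_avg_powr[OF N, symmetric] by simp
  also have "\<dots> \<le> (K powr q * real (N ^ CARD('d)) powr q * local_avg N J x n powr q) * ?W"
    using cube_weight_pos[OF N, of "dil N n"] powr_mono[OF q_ge1 K_ge1] K_ge1
    by (intro mult_right_mono) auto
  also have "K powr q * real (N ^ CARD('d)) powr q * local_avg N J x n powr q
     = (K * real (N ^ CARD('d)) * local_avg N J x n) powr q"
    by (simp only: powr_mult)
  finally have "(\<Sum>j\<in>?Q. y j) powr q \<le> (K * real (N ^ CARD('d)) * local_avg N J x n) powr q"
    using cube_weight_pos[OF N, of "dil N n"] by (simp only: mult_le_cancel_right_pos)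
  then have "(\<Sum>j\<in>?Q. y j) \<le> K * real (N ^ CARD('d)) * local_avg N J x n"
    using K_ge1 q_ge1 by (intro powr_le_cancel_base[of "\<Sum>j\<in>?Q. y j" q]) auto
  then show ?thesis unfolding e1 .
qed

lemma neighbour_weight_le:
  assumes N: "1 \<le> N"
  shows "(\<Sum>i | lnorm (quot N i - n) \<le> r. w i)
    \<le> K * real ((2 * r + 1) ^ CARD('d)) powr q * (\<Sum>j\<in>cube (dil N n) N. w j)"
  unfolding quot_near_eq_cube[OF N]
proof (rule doubling[OF N])
  show "cube (dil N n) N \<subseteq> cube (dil N (n - (\<chi> m. int r))) ((2 * r + 1) * N)"
    unfolding quot_near_eq_cube[OF N, symmetric] by (auto simp: mem_cube_dil_iff[OF N])
qed simp

lemma cell_weight_le: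
  assumes N: "1 \<le> N" and r: "lnorm (p - n) \<le> r"
  shows "(\<Sum>j\<in>cube (dil N p) N. w j)
    \<le> K * real ((2 * r + 1) ^ CARD('d)) powr q * (\<Sum>j\<in>cube (dil N n) N. w j)"
proof -
  have "(\<Sum>j\<in>cube (dil N p) N. w j) \<le> (\<Sum>i | lnorm (quot N i - n) \<le> r. w i)"
    using r w_nonneg finite_cube
    by (intro sum_mono2) (auto simp: mem_cube_dil_iff[OF N], simp add: quot_near_eq_cube[OF N])
  also note neighbour_weight_le[OF N]
  finally show ?thesis .
qed

text \<open>The distance to the corner of cell \<open>n\<close>, divided by \<open>N\<close>, is
  subtracted from 2 and clamped to the interval from 0 to 1. Points of the cell have distance at
  most \<open>N\<close>, and a cell distance of at least 3 forces distance at least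
  \<open>2 * N\<close>.\<close>

lemma cutoff:
  assumes N: "1 \<le> N"
  obtains \<psi> :: "int ^ 'd \<Rightarrow> real" where "\<And>i. 0 \<le> \<psi> i" "\<And>i. \<psi> i \<le> 1"
    "\<And>i. quot N i = n \<Longrightarrow> \<psi> i = 1" "\<And>i. 2 < lnorm (quot N i - n) \<Longrightarrow> \<psi> i = 0"
    "\<And>i j. \<bar>\<psi> j - \<psi> i\<bar> \<le> real (lnorm (i - j)) / real N"
proof -
  define \<rho> where "\<rho> i = lnorm (i - dil N n)" for i
  have qd: "quot N (dil N n) = n"
    using N by (simp add: quot_def dil_def vec_eq_iff)
  define \<psi> where "\<psi> i = max 0 (min 1 (2 - real (\<rho> i) / real N))" for i
  show thesis
  proof (rule that)
    show "0 \<le> \<psi> i" "\<psi> i \<le> 1" for i by (auto simp: \<psi>_def)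
    show "\<psi> i = 1" if "quot N i = n" for i
    proof -
      have "\<rho> i \<le> N" using lnorm_le_quot[OF N, of i "dil N n"] that by (simp add: qd \<rho>_def)
      then have "real (\<rho> i) / real N \<le> 1" using N by simp
      then show ?thesis by (simp add: \<psi>_def)
    qed
    show "\<psi> i = 0" if "2 < lnorm (quot N i - n)" for i
    proof -
      have "N * 3 \<le> N * lnorm (quot N i - n)" using that by (intro mult_le_mono) auto
      also have "\<dots> \<le> \<rho> i + N" using lnorm_ge_quot[OF N, of i "dil N n"] by (simp add: qd \<rho>_def)
      finally have "2 * real N \<le> real (\<rho> i)" by linarith
      then have "2 \<le> real (\<rho> i) / real N" using N by (simp add: le_divide_eq)
      then show ?thesis by (simp add: \<psi>_def)
    qed
    show "\<bar>\<psi> j - \<psi> i\<bar> \<le> real (lnorm (i - j)) / real N" for i j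
    proof -
      have "\<rho> j \<le> lnorm (j - i) + \<rho> i" "\<rho> i \<le> lnorm (i - j) + \<rho> j"
        unfolding \<rho>_def by (rule lnorm_triangle3)+
      then have "\<bar>real (\<rho> i) - real (\<rho> j)\<bar> \<le> real (lnorm (i - j))"
        unfolding lnorm_minus_commute[of j i] by linarith
      then have "\<bar>real (\<rho> i) - real (\<rho> j)\<bar> / real N \<le> real (lnorm (i - j)) / real N"
        by (intro divide_right_mono) auto
      moreover have "\<bar>real (\<rho> i) - real (\<rho> j)\<bar> / real N = \<bar>real (\<rho> i) / real N - real (\<rho> j) / real N\<bar>"
        using N by (simp flip: diff_divide_distrib)
      moreover have "\<bar>\<psi> j - \<psi> i\<bar> \<le> \<bar>real (\<rho> i) / real N - real (\<rho> j) / real N\<bar>"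
        unfolding \<psi>_def by linarith
      ultimately show ?thesis by linarith
    qed
  qed
qed

text \<open>Stability is applied to \<open>\<psi>c\<close>. The commutator of \<open>A\<close> and \<open>\<psi>\<close> is split according to the distance
  of the cell of \<open>j\<close> from \<open>n\<close>: near \<open>n\<close> it is small as an operator because \<open>\<psi>\<close> is \<open>1/N\<close>-Lipschitz, far
  from \<open>n\<close> because \<open>\<psi>(j) = 0\<close> and \<open>h\<close> decays. The weights enter only through \<open>local_avg\<close>, and \<open>\<kappa>\<close>
  depends neither on \<open>m\<close> nor on \<open>L\<close>.\<close>

lemma local_estimate:
  fixes A :: "'d imatrix"
  assumes h: "radial_kernel TYPE('d) h H" and A: "\<And>i j. cmod (A i j) \<le> h (lnorm (i - j))"
    and C0: "0 \<le> C0"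
    and stab: "\<And>J c T. finite J \<Longrightarrow>
        (\<And>I. finite I \<Longrightarrow> (\<Sum>i\<in>I. w i * cmod (\<Sum>j\<in>J. A i j * c j) powr q) \<le> T) \<Longrightarrow>
        (\<Sum>j\<in>J. cmod (c j) powr q * w j) \<le> C0 * T"
    and m: "1 \<le> m" and L: "1 \<le> L" and N_def: "N = m * L"
    and tail: "radial_kernel TYPE('d) (\<lambda>r. h (max r m)) \<tau>" and \<delta>: "H / real L + \<tau> \<le> \<delta>"
    and J: "finite J"
    and \<kappa>_def: "\<kappa> = (C0 * 3 powr q * conv_const * K * real (13 ^ CARD('d)) powr q + 1) * K"
  shows "local_avg N J (\<lambda>j. cmod (c j)) n
    \<le> \<kappa> * (\<Sum>i | lnorm (quot N i - n) \<le> 2. cmod (\<Sum>j\<in>J. A i j * c j))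
      + (\<Sum>p\<in>quot N ` J. \<kappa> * (\<delta> * (if lnorm (n - p) \<le> 6 then 1 else 0) +
           real (N ^ CARD('d)) * h (max (N * (lnorm (n - p) div 4 + 1)) m))
         * local_avg N J (\<lambda>j. cmod (c j)) p)"
proof -
  note h_mono = radial_kernelD(1)[OF h] and h_nonneg = radial_kernelD(2)[OF h]
  have N: "1 \<le> N" using m L by (simp add: N_def)
  have mN: "m \<le> N" using L by (simp add: N_def)
  have H0: "0 \<le> H" and \<tau>0: "0 \<le> \<tau>" using radial_kernelD(5) h tail by blast+
  have \<delta>0: "0 \<le> \<delta>" using H0 \<tau>0 \<delta> by (meson add_nonneg_nonneg divide_nonneg_nonneg of_nat_0_le_iff order_trans)
  define x where "x j = cmod (c j)" for j
  define D where "D = local_avg N J x"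
  have D0: "0 \<le> D p" for p by (simp add: D_def)
  define y where "y i = (\<Sum>j\<in>J. A i j * c j)" for i
  define Q where "Q = (\<Sum>j\<in>cube (dil N n) N. w j)"
  have Q: "Q > 0" unfolding Q_def by (rule cube_weight_pos[OF N])
  define B where "B = {i. lnorm (quot N i - n) \<le> 2}"
  have finB: "finite B" unfolding B_def quot_near_eq_cube[OF N] by simp
  define wB where "wB = (\<Sum>i\<in>B. w i)"
  have wB: "wB \<le> K * real (5 ^ CARD('d)) powr q * Q"
    unfolding wB_def B_def Q_def using neighbour_weight_le[OF N, of n 2] by simp
  define G where "G = (\<Sum>i\<in>B. cmod (y i))"
  have G0: "0 \<le> G" by (simp add: G_def sum_nonneg)
  define P where "P = quot N ` J"
  have finP: "finite P" using J by (simp add: P_def)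
  obtain \<psi> :: "int ^ 'd \<Rightarrow> real" where \<psi>: "\<And>i. 0 \<le> \<psi> i" "\<And>i. \<psi> i \<le> 1"
    "\<And>i. quot N i = n \<Longrightarrow> \<psi> i = 1" "\<And>i. 2 < lnorm (quot N i - n) \<Longrightarrow> \<psi> i = 0"
    "\<And>i j. \<bar>\<psi> j - \<psi> i\<bar> \<le> real (lnorm (i - j)) / real N"
    using cutoff[OF N, of n] by metis
  define J1 where "J1 = {j\<in>J. lnorm (quot N j - n) \<le> 6}"
  define J2 where "J2 = {j\<in>J. 6 < lnorm (quot N j - n)}"
  have J12: "J = J1 \<union> J2" "J1 \<inter> J2 = {}" "finite J1" "finite J2"
    using J by (auto simp: J1_def J2_def)
  \<comment> \<open>Entries at distance at most \<open>m\<close> gain \<open>m / N = 1 / L\<close>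
    from the Lipschitz bound of \<psi>. Longer ones use that \<psi> varies by at most 1, and the
    tail of \<open>h\<close>.\<close>
  define u where "u r = (1 / real L) * h r + h (max r m)" for r
  have u: "radial_kernel TYPE('d) u \<delta>"
    unfolding u_def using \<delta>
    by (intro radial_kernel_le[OF radial_kernel_add[OF radial_kernel_cmult[OF h] tail]]) auto
  define v where "v r = real (N ^ CARD('d)) * h (max (N * (r div 4 + 1)) m)" for r
  have v0: "0 \<le> v r" for r using h_nonneg by (simp add: v_def)
  define Y where "Y = (\<Sum>p\<in>{p\<in>P. lnorm (n - p) \<le> 6}. D p)"
  have Y0: "0 \<le> Y" using D0 by (simp add: Y_def sum_nonneg)
  define X where "X = (\<Sum>p\<in>P. K * v (lnorm (n - p)) * D p)"
  have X0: "0 \<le> X" unfolding X_def using D0 v0 K_ge1 by (intro sum_nonneg mult_nonneg_nonneg) auto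

  have comm: "cmod (A i j) * \<bar>\<psi> j - \<psi> i\<bar> \<le> u (lnorm (i - j))" for i j
  proof (cases "lnorm (i - j) \<le> m")
    case True
    then have "real (lnorm (i - j)) / real N \<le> real m / real N" by (intro divide_right_mono) auto
    also have "\<dots> = 1 / real L" using m by (simp add: N_def)
    finally have "\<bar>\<psi> j - \<psi> i\<bar> \<le> 1 / real L" using \<psi>(5)[of j i] by simp
    then have "cmod (A i j) * \<bar>\<psi> j - \<psi> i\<bar> \<le> h (lnorm (i - j)) * (1 / real L)"
      using A h_nonneg by (intro mult_mono) auto
    then show ?thesis using h_nonneg[of "max (lnorm (i - j)) m"] by (simp add: u_def)
  next
    case False
    have "\<bar>\<psi> j - \<psi> i\<bar> \<le> 1" using \<psi>(1,2)[of i] \<psi>(1,2)[of j] by linarith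
    then have "cmod (A i j) * \<bar>\<psi> j - \<psi> i\<bar> \<le> h (lnorm (i - j)) * 1"
      using A h_nonneg by (intro mult_mono) auto
    moreover have "0 \<le> (1 / real L) * h (lnorm (i - j))" using h_nonneg by simp
    ultimately show ?thesis using False by (simp add: u_def max_def)
  qed
  \<comment> \<open>The factor \<open>\<psi> i\<close> makes the bound valid for every
    \<open>i\<close>: outside \<open>B\<close> both sides vanish, and inside \<open>B\<close> all
    points of \<open>J2\<close> are far away.\<close>
  have far: "\<psi> i * (\<Sum>j\<in>J2. cmod (A i j) * x j) \<le> \<psi> i * X" for i
  proof (cases "i \<in> B")
    case False
    then show ?thesis using \<psi>(4)[of i] by (simp add: B_def)
  next
    case True
    have "(\<Sum>j\<in>J2. cmod (A i j) * x j) \<le> (\<Sum>j\<in>J2. h (max (N * (lnorm (n - quot N j) div 4 + 1)) m) * x j)"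
    proof (intro sum_mono mult_right_mono)
      fix j assume "j \<in> J2"
      define r where "r = lnorm (n - quot N j)"
      have r: "6 < r" using \<open>j \<in> J2\<close> by (simp add: r_def J2_def lnorm_minus_commute)
      have "r \<le> lnorm (n - quot N i) + lnorm (quot N i - quot N j)"
        unfolding r_def by (rule lnorm_triangle3)
      also have "lnorm (n - quot N i) \<le> 2" using True by (simp add: B_def lnorm_minus_commute)
      \<comment> \<open>Since \<open>r > 6\<close>, the remaining distance \<open>r - 2\<close> is
        large enough. The second \<open>+ 1\<close> is the cell lost in
        \<open>lnorm_ge_quot\<close>.\<close>
      finally have "r div 4 + 1 + 1 \<le> lnorm (quot N i - quot N j)" using r by linarith
      then have "N * (r div 4 + 1 + 1) \<le> N * lnorm (quot N i - quot N j)" by (intro mult_le_mono) auto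
      also have "\<dots> \<le> lnorm (i - j) + N" by (rule lnorm_ge_quot[OF N])
      finally have *: "N * (r div 4 + 1) \<le> lnorm (i - j)" by simp
      have "m \<le> N * (r div 4 + 1)" using mN by (simp add: trans_le_add1)
      with * have "max (N * (r div 4 + 1)) m \<le> lnorm (i - j)" by simp
      then show "cmod (A i j) \<le> h (max (N * (lnorm (n - quot N j) div 4 + 1)) m)"
        unfolding r_def[symmetric] using A[of i j] h_mono by (meson order_trans)
    qed (simp add: x_def)
    also have "\<dots> \<le> (\<Sum>j\<in>J. h (max (N * (lnorm (n - quot N j) div 4 + 1)) m) * x j)"
      using J h_nonneg by (intro sum_mono2) (auto simp: J2_def x_def)
    also have "\<dots> = (\<Sum>p\<in>P. \<Sum>j\<in>{j\<in>J. quot N j = p}. h (max (N * (lnorm (n - quot N j) div 4 + 1)) m) * x j)"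
      unfolding P_def using J by (intro sum.image_gen)
    also have "\<dots> = (\<Sum>p\<in>P. h (max (N * (lnorm (n - p) div 4 + 1)) m) * (\<Sum>j\<in>{j\<in>J. quot N j = p}. x j))"
      by (intro sum.cong refl) (auto simp: sum_distrib_left)
    also have "\<dots> \<le> (\<Sum>p\<in>P. h (max (N * (lnorm (n - p) div 4 + 1)) m) * (K * real (N ^ CARD('d)) * D p))"
      unfolding D_def using h_nonneg
      by (intro sum_mono mult_left_mono cell_sum_le_local_avg N J) (auto simp: x_def)
    also have "\<dots> = X" by (simp add: X_def v_def mult_ac)
    finally show ?thesis using \<psi>(1) by (intro mult_left_mono)
  qed
  define y' where "y' i = (\<Sum>j\<in>J. A i j * (of_real (\<psi> j) * c j))" for i
  have y': "cmod (y' i) \<le> \<psi> i * cmod (y i) + (\<Sum>j\<in>J1. u (lnorm (i - j)) * x j) + \<psi> i * X" for i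
  proof -
    have "y' i = of_real (\<psi> i) * y i + (\<Sum>j\<in>J. A i j * of_real (\<psi> j - \<psi> i) * c j)"
      unfolding y'_def y_def by (simp add: algebra_simps sum_distrib_left sum_subtractf flip: sum.distrib)
    also have "(\<Sum>j\<in>J. A i j * of_real (\<psi> j - \<psi> i) * c j)
      = (\<Sum>j\<in>J1. A i j * of_real (\<psi> j - \<psi> i) * c j) + (\<Sum>j\<in>J2. A i j * of_real (\<psi> j - \<psi> i) * c j)"
      unfolding J12(1) using J12 by (intro sum.union_disjoint) auto
    finally have "cmod (y' i) \<le> cmod (of_real (\<psi> i) * y i)
       + (cmod (\<Sum>j\<in>J1. A i j * of_real (\<psi> j - \<psi> i) * c j) + cmod (\<Sum>j\<in>J2. A i j * of_real (\<psi> j - \<psi> i) * c j))"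
      by (smt (verit) norm_triangle_ineq)
    moreover have "cmod (of_real (\<psi> i) * y i) = \<psi> i * cmod (y i)" using \<psi>(1) by (simp add: norm_mult)
    moreover have "cmod (\<Sum>j\<in>J1. A i j * of_real (\<psi> j - \<psi> i) * c j) \<le> (\<Sum>j\<in>J1. u (lnorm (i - j)) * x j)"
    proof (rule sum_norm_le)
      fix j
      have "cmod (A i j * of_real (\<psi> j - \<psi> i) * c j) = cmod (A i j) * \<bar>\<psi> j - \<psi> i\<bar> * x j"
        by (simp only: norm_mult norm_of_real x_def)
      also have "\<dots> \<le> u (lnorm (i - j)) * x j" by (intro mult_right_mono comm) (simp add: x_def)
      finally show "cmod (A i j * of_real (\<psi> j - \<psi> i) * c j) \<le> u (lnorm (i - j)) * x j" .
    qed
    moreover have "cmod (\<Sum>j\<in>J2. A i j * of_real (\<psi> j - \<psi> i) * c j) \<le> \<psi> i * X"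
    proof -
      have "cmod (\<Sum>j\<in>J2. A i j * of_real (\<psi> j - \<psi> i) * c j) \<le> (\<Sum>j\<in>J2. \<psi> i * (cmod (A i j) * x j))"
      proof (rule sum_norm_le)
        fix j assume "j \<in> J2"
        then have "\<psi> j = 0" using \<psi>(4)[of j] by (simp add: J2_def)
        then show "cmod (A i j * of_real (\<psi> j - \<psi> i) * c j) \<le> \<psi> i * (cmod (A i j) * x j)"
          using \<psi>(1)[of i] by (simp add: norm_mult x_def)
      qed
      then show ?thesis using far[of i] by (simp add: sum_distrib_left)
    qed
    ultimately show ?thesis by linarith
  qed
  \<comment> \<open>Bounds for the three parts of \<open>y'\<close>. Doubling compares the weight of
    the 5^d cells that may carry \<psi>, and of each of the 13^d cells that may meet
    \<open>J1\<close>, with \<open>Q\<close>. All three bounds thus contain \<open>Q\<close>, which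
    will cancel.\<close>
  define E1 where "E1 = K * real (5 ^ CARD('d)) powr q * Q * G powr q"
  define E2 where "E2 = conv_const * \<delta> powr q * (K * real (13 ^ CARD('d)) powr q * Q * Y powr q)"
  define E3 where "E3 = K * real (5 ^ CARD('d)) powr q * Q * X powr q"
  have "(\<Sum>i\<in>I. w i * cmod (y' i) powr q) \<le> 3 powr q * (E1 + E2 + E3)" if I: "finite I" for I
  proof -
    have u0: "0 \<le> u r" for r using radial_kernelD(2)[OF u] .
    have s0: "0 \<le> (\<Sum>j\<in>J1. u (lnorm (i - j)) * x j)" for i
      using u0 by (intro sum_nonneg) (auto simp: x_def)
    have restrict: "(\<Sum>i\<in>I. w i * (\<psi> i * g i) powr q) \<le> (\<Sum>i\<in>B. w i * g i powr q)"
      if g: "\<And>i. 0 \<le> g i" for g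
    proof -
      have "(\<Sum>i\<in>I. w i * (\<psi> i * g i) powr q) = (\<Sum>i\<in>I \<inter> B. w i * (\<psi> i * g i) powr q)"
        using I \<psi>(4) by (intro sum.mono_neutral_right) (auto simp: B_def not_le)
      also have "\<dots> \<le> (\<Sum>i\<in>I \<inter> B. w i * g i powr q)"
        using \<psi>(1,2) g q_ge1 w_nonneg
        by (intro sum_mono mult_left_mono powr_mono2 mult_left_le_one_le mult_nonneg_nonneg) auto
      also have "\<dots> \<le> (\<Sum>i\<in>B. w i * g i powr q)"
        using finB w_nonneg by (intro sum_mono2) auto
      finally show ?thesis .
    qed
    have "(\<Sum>i\<in>I. w i * cmod (y' i) powr q)
      \<le> (\<Sum>i\<in>I. w i * (3 powr q * ((\<psi> i * cmod (y i)) powr q +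
           (\<Sum>j\<in>J1. u (lnorm (i - j)) * x j) powr q + (\<psi> i * X) powr q)))"
    proof (intro sum_mono mult_left_mono w_nonneg)
      fix i
      have "cmod (y' i) powr q \<le> (\<psi> i * cmod (y i) + (\<Sum>j\<in>J1. u (lnorm (i - j)) * x j) + \<psi> i * X) powr q"
        using q_ge1 by (intro powr_mono2 y') auto
      also have "\<dots> \<le> 3 powr q * ((\<psi> i * cmod (y i)) powr q +
           (\<Sum>j\<in>J1. u (lnorm (i - j)) * x j) powr q + (\<psi> i * X) powr q)"
        using q_ge1 \<psi>(1) X0 s0 by (intro powr_add3_le) auto
      finally show "cmod (y' i) powr q \<le> 3 powr q * ((\<psi> i * cmod (y i)) powr q +
           (\<Sum>j\<in>J1. u (lnorm (i - j)) * x j) powr q + (\<psi> i * X) powr q)" .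
    qed
    also have "\<dots> = 3 powr q * ((\<Sum>i\<in>I. w i * (\<psi> i * cmod (y i)) powr q) +
        (\<Sum>i\<in>I. w i * (\<Sum>j\<in>J1. u (lnorm (i - j)) * x j) powr q) + (\<Sum>i\<in>I. w i * (\<psi> i * X) powr q))"
      by (simp add: sum_distrib_left sum.distrib algebra_simps)
    also have "\<dots> \<le> 3 powr q * (E1 + E2 + E3)"
    proof (intro mult_left_mono add_mono)
      have "(\<Sum>i\<in>I. w i * (\<psi> i * cmod (y i)) powr q) \<le> (\<Sum>i\<in>B. w i * cmod (y i) powr q)"
        by (rule restrict) simp
      also have "\<dots> \<le> (\<Sum>i\<in>B. w i * G powr q)"
        using finB q_ge1 w_nonneg unfolding G_def
        by (intro sum_mono mult_left_mono powr_mono2 member_le_sum) auto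
      also have "\<dots> = wB * G powr q" by (simp add: wB_def sum_distrib_right)
      also have "\<dots> \<le> E1" unfolding E1_def by (intro mult_right_mono wB) auto
      finally show "(\<Sum>i\<in>I. w i * (\<psi> i * cmod (y i)) powr q) \<le> E1" .
      have "(\<Sum>i\<in>I. w i * (\<psi> i * X) powr q) \<le> (\<Sum>i\<in>B. w i * X powr q)"
        by (rule restrict) (rule X0)
      also have "\<dots> = wB * X powr q" by (simp add: wB_def sum_distrib_right)
      also have "\<dots> \<le> E3" unfolding E3_def by (intro mult_right_mono wB) auto
      finally show "(\<Sum>i\<in>I. w i * (\<psi> i * X) powr q) \<le> E3" .
      let ?Z = "\<Sum>j\<in>J1. x j powr q * w j"
      have "(\<Sum>i\<in>I. w i * (\<Sum>j\<in>J1. u (lnorm (i - j)) * x j) powr q) \<le> conv_const * \<delta> powr q * ?Z"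
        by (intro convolution_bound u I J12) (simp add: x_def)
      also have "?Z \<le> K * real (13 ^ CARD('d)) powr q * Q * Y powr q"
      proof -
        have "?Z = (\<Sum>p\<in>quot N ` J1. \<Sum>j\<in>{j\<in>J1. quot N j = p}. x j powr q * w j)"
          using J12 by (intro sum.image_gen)
        also have "\<dots> = (\<Sum>p\<in>{p\<in>P. lnorm (n - p) \<le> 6}. \<Sum>j\<in>{j\<in>J. quot N j = p}. x j powr q * w j)"
          by (intro sum.cong) (auto simp: J1_def P_def lnorm_minus_commute)
        also have "\<dots> = (\<Sum>p\<in>{p\<in>P. lnorm (n - p) \<le> 6}. D p powr q * (\<Sum>j\<in>cube (dil N p) N. w j))"
          unfolding D_def local_avg_powr[OF N] ..
        also have "\<dots> \<le> (\<Sum>p\<in>{p\<in>P. lnorm (n - p) \<le> 6}. D p powr q * (K * real (13 ^ CARD('d)) powr q * Q))"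
        proof (intro sum_mono mult_left_mono)
          fix p assume "p \<in> {p\<in>P. lnorm (n - p) \<le> 6}"
          then have "lnorm (p - n) \<le> 6" by (simp add: lnorm_minus_commute)
          from cell_weight_le[OF N this]
          show "(\<Sum>j\<in>cube (dil N p) N. w j) \<le> K * real (13 ^ CARD('d)) powr q * Q" by (simp add: Q_def)
        qed auto
        also have "\<dots> = (K * real (13 ^ CARD('d)) powr q * Q) * (\<Sum>p\<in>{p\<in>P. lnorm (n - p) \<le> 6}. D p powr q)"
          by (simp only: sum_distrib_right[symmetric] mult.commute)
        also have "\<dots> \<le> (K * real (13 ^ CARD('d)) powr q * Q) * Y powr q"
          unfolding Y_def using Q K_ge1 q_ge1 D0 finP
          by (intro mult_left_mono sum_powr_le_powr_sum) auto
        finally show ?thesis .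
      qed
      finally show "(\<Sum>i\<in>I. w i * (\<Sum>j\<in>J1. u (lnorm (i - j)) * x j) powr q) \<le> E2"
        unfolding E2_def using conv_const_ge1 by (simp add: mult_left_mono)
    qed simp
    finally show ?thesis .
  qed
  then have "(\<Sum>j\<in>J. cmod (of_real (\<psi> j) * c j) powr q * w j) \<le> C0 * (3 powr q * (E1 + E2 + E3))"
    unfolding y'_def by (intro stab J)
  moreover have "D n powr q * Q \<le> (\<Sum>j\<in>J. cmod (of_real (\<psi> j) * c j) powr q * w j)"
  proof -
    have "D n powr q * Q = (\<Sum>j\<in>{j\<in>J. quot N j = n}. x j powr q * w j)"
      unfolding D_def Q_def by (rule local_avg_powr[OF N])
    also have "\<dots> = (\<Sum>j\<in>{j\<in>J. quot N j = n}. cmod (of_real (\<psi> j) * c j) powr q * w j)"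
      using \<psi>(3) by (intro sum.cong refl) (auto simp: x_def)
    also have "\<dots> \<le> (\<Sum>j\<in>J. cmod (of_real (\<psi> j) * c j) powr q * w j)"
      using J w_nonneg by (intro sum_mono2) auto
    finally show ?thesis .
  qed
  ultimately have main: "D n powr q * Q \<le> C0 * (3 powr q * (E1 + E2 + E3))" by linarith
  define M where "M = conv_const * K * real (13 ^ CARD('d)) powr q"
  \<comment> \<open>The added 1 ensures \<open>\<kappa>0 \<le> \<kappa>0 powr q\<close>, so the
    constant can be moved inside the \<open>q\<close>-th power. The further factor \<open>K\<close>
    in \<kappa> gives \<open>G\<close> and \<open>Y\<close> the constant that \<open>X\<close>
    already carries.\<close>
  define \<kappa>0 where "\<kappa>0 = C0 * 3 powr q * M + 1"
  have M0: "0 \<le> M" using conv_const_ge1 K_ge1 by (simp add: M_def)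
  have \<kappa>0: "1 \<le> \<kappa>0" using M0 C0 by (simp add: \<kappa>0_def)
  have KM: "K * real (5 ^ CARD('d)) powr q \<le> M"
  proof -
    have "1 * (K * real (5 ^ CARD('d)) powr q) \<le> conv_const * (K * real (13 ^ CARD('d)) powr q)"
      using K_ge1 q_ge1 conv_const_ge1
      by (intro mult_mono powr_mono2) (auto intro: power_mono)
    then show ?thesis by (simp add: M_def mult_ac)
  qed
  have "E1 \<le> M * Q * G powr q" "E3 \<le> M * Q * X powr q"
    unfolding E1_def E3_def using Q KM by (intro mult_right_mono; simp)+
  moreover have "E2 = M * Q * (\<delta> * Y) powr q"
    unfolding E2_def M_def using \<delta>0 Y0 by (simp add: powr_mult mult_ac)
  ultimately have "E1 + E2 + E3 \<le> M * Q * (G powr q + (\<delta> * Y) powr q + X powr q)"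
    by (simp add: distrib_left)
  then have "C0 * (3 powr q * (E1 + E2 + E3)) \<le> C0 * (3 powr q * (M * Q * (G powr q + (\<delta> * Y) powr q + X powr q)))"
    using C0 by (intro mult_left_mono) auto
  also have "\<dots> = (C0 * 3 powr q * M) * (G powr q + (\<delta> * Y) powr q + X powr q) * Q" by (simp add: mult_ac)
  also have "\<dots> \<le> \<kappa>0 * (G powr q + (\<delta> * Y) powr q + X powr q) * Q"
    unfolding \<kappa>0_def using Q by (intro mult_right_mono) auto
  finally have "D n powr q * Q \<le> \<kappa>0 * (G powr q + (\<delta> * Y) powr q + X powr q) * Q" using main by linarith
  then have "D n powr q \<le> \<kappa>0 * (G powr q + (\<delta> * Y) powr q + X powr q)"
    using Q by (simp only: mult_le_cancel_right_pos)
  \<comment> \<open>Superadditivity of the \<open>q\<close>-th power makes the estimate linear, the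
    form in which it can be iterated or absorbed.\<close>
  also have "G powr q + (\<delta> * Y) powr q + X powr q \<le> (G + \<delta> * Y + X) powr q"
  proof -
    have "(\<Sum>k\<in>{0, 1, 2 :: nat}. [G, \<delta> * Y, X] ! k powr q) \<le> (\<Sum>k\<in>{0, 1, 2 :: nat}. [G, \<delta> * Y, X] ! k) powr q"
      using G0 Y0 X0 \<delta>0 q_ge1 by (intro sum_powr_le_powr_sum) auto
    then show ?thesis by (simp add: add.assoc)
  qed
  also have "\<kappa>0 * (G + \<delta> * Y + X) powr q \<le> \<kappa>0 powr q * (G + \<delta> * Y + X) powr q"
    using powr_mono[OF q_ge1 \<kappa>0] \<kappa>0 by (intro mult_right_mono) auto
  also have "\<dots> = (\<kappa>0 * (G + \<delta> * Y + X)) powr q" by (simp only: powr_mult)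
  finally have "D n powr q \<le> (\<kappa>0 * (G + \<delta> * Y + X)) powr q" using \<kappa>0 by simp
  then have "D n \<le> \<kappa>0 * (G + \<delta> * Y + X)"
    using q_ge1 \<kappa>0 G0 Y0 X0 \<delta>0 by (intro powr_le_cancel_base[of "D n" q]) auto
  also have "\<dots> \<le> \<kappa>0 * (K * G + K * (\<delta> * Y) + X)"
  proof (intro mult_left_mono add_mono)
    have *: "z \<le> K * z" if "0 \<le> z" for z using mult_right_mono[OF K_ge1 that] by simp
    show "G \<le> K * G" "\<delta> * Y \<le> K * (\<delta> * Y)" using G0 Y0 \<delta>0 by (auto intro!: *)
  qed (use \<kappa>0 in auto)
  also have "\<dots> = \<kappa> * G + (\<kappa>0 * (K * (\<delta> * Y)) + \<kappa>0 * X)"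
    unfolding \<kappa>_def \<kappa>0_def M_def by (simp add: algebra_simps)
  also have "\<kappa>0 * (K * (\<delta> * Y)) + \<kappa>0 * X
     = (\<Sum>p\<in>P. \<kappa> * (\<delta> * (if lnorm (n - p) \<le> 6 then 1 else 0) + v (lnorm (n - p))) * D p)"
  proof -
    have "Y = (\<Sum>p\<in>P. (if lnorm (n - p) \<le> 6 then 1 else 0) * D p)"
      unfolding Y_def using finP by (subst sum.inter_filter) (auto intro: sum.cong)
    moreover have "\<kappa> = \<kappa>0 * K" by (simp add: \<kappa>_def \<kappa>0_def M_def mult_ac)
    ultimately show ?thesis
      unfolding X_def by (simp add: sum_distrib_left algebra_simps flip: sum.distrib)
  qed
  finally show ?thesis
    unfolding D_def x_def P_def v_def G_def y_def B_def by simp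
qed

end

section \<open>Absorption of the cell kernel\<close>

context muckenhoupt
begin

text \<open>Pairing the local estimates with \<open>W(|a - n|)\<close> lets the kernel \<open>V\<close> be absorbed in one step, in
  place of a Neumann series.\<close>

lemma pointwise_bound:
  fixes A :: "'d imatrix"
  assumes h: "radial_kernel TYPE('d) h H" and A: "\<And>i j. cmod (A i j) \<le> h (lnorm (i - j))"
    and C0: "0 \<le> C0"
    and stab: "\<And>J c T. finite J \<Longrightarrow>
        (\<And>I. finite I \<Longrightarrow> (\<Sum>i\<in>I. w i * cmod (\<Sum>j\<in>J. A i j * c j) powr q) \<le> T) \<Longrightarrow>
        (\<Sum>j\<in>J. cmod (c j) powr q * w j) \<le> C0 * T"
  obtains \<Phi> S where "radial_kernel TYPE('d) \<Phi> S"
    "\<And>J c i. finite J \<Longrightarrow> i \<in> J \<Longrightarrow>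
       \<exists>I. finite I \<and> cmod (c i) \<le> (\<Sum>k\<in>I. \<Phi> (lnorm (i - k)) * cmod (\<Sum>j\<in>J. A k j * c j))"
proof -
  have H0: "0 \<le> H" using radial_kernelD(5)[OF h] .
  define \<kappa> where "\<kappa> = (C0 * 3 powr q * conv_const * K * real (13 ^ CARD('d)) powr q + 1) * K"
  have \<kappa>: "\<kappa> > 0"
    unfolding \<kappa>_def using C0 conv_const_ge1 K_ge1
    by (intro mult_pos_pos add_nonneg_pos mult_nonneg_nonneg) auto
  define s where "s = 1 / 4 ^ (CARD('d) + 2) / \<kappa>"
  have s: "s > 0" using \<kappa> by (simp add: s_def)
  define \<delta> where "\<delta> = s / (2 * 13 ^ CARD('d))"
  have \<delta>: "\<delta> > 0" using s by (simp add: \<delta>_def)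
  define \<tau> where "\<tau> = min (\<delta> / 2) (s / (2 * 8 ^ CARD('d)))"
  have \<tau>: "\<tau> > 0" using s \<delta> by (simp add: \<tau>_def)
  obtain m where m: "1 \<le> m" and tail: "radial_kernel TYPE('d) (\<lambda>r. h (max r m)) \<tau>"
    by (rule radial_kernel_tail[OF h \<tau>])
  define L where "L = Suc (nat \<lceil>2 * H / \<delta>\<rceil>)"
  have L: "1 \<le> L" by (simp add: L_def)
  have "2 * H / \<delta> \<le> real L" unfolding L_def by linarith
  then have "H / real L \<le> \<delta> / 2" using \<delta> L by (simp add: field_simps)
  moreover have "\<tau> \<le> \<delta> / 2" by (simp add: \<tau>_def)
  ultimately have \<delta>_le: "H / real L + \<tau> \<le> \<delta>" by linarith
  define N where "N = m * L"
  have N: "1 \<le> N" using m L by (simp add: N_def)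
  define V where "V r = \<kappa> * (\<delta> * (if r \<le> 6 then 1 else 0) +
           real (N ^ CARD('d)) * h (max (N * (r div 4 + 1)) m))" for r
  have "radial_kernel TYPE('d) V (\<kappa> * (\<delta> * real ((2 * 6 + 1) ^ CARD('d)) + real ((2 * 4) ^ CARD('d)) * \<tau>))"
    unfolding V_def
    using \<kappa> \<delta> radial_kernel_div[OF radial_kernel_block[OF tail N], of 4]
    by (intro radial_kernel_cmult radial_kernel_add radial_kernel_ball) auto
  moreover have "\<kappa> * (\<delta> * real ((2 * 6 + 1) ^ CARD('d)) + real ((2 * 4) ^ CARD('d)) * \<tau>) \<le> 1 / 4 ^ (CARD('d) + 2)"
  proof -
    have "real ((2 * 4) ^ CARD('d)) * \<tau> \<le> real ((2 * 4) ^ CARD('d)) * (s / (2 * 8 ^ CARD('d)))"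
      by (intro mult_left_mono) (auto simp: \<tau>_def)
    also have "\<dots> = s / 2" by simp
    finally have "\<delta> * real ((2 * 6 + 1) ^ CARD('d)) + real ((2 * 4) ^ CARD('d)) * \<tau> \<le> s / 2 + s / 2"
      by (intro add_mono) (auto simp: \<delta>_def)
    then have "\<kappa> * (\<delta> * real ((2 * 6 + 1) ^ CARD('d)) + real ((2 * 4) ^ CARD('d)) * \<tau>) \<le> \<kappa> * s"
      using \<kappa> by (intro mult_left_mono) auto
    then show ?thesis using \<kappa> by (simp add: s_def)
  qed
  moreover have "0 < V 0"
    unfolding V_def using \<kappa> \<delta> radial_kernelD(2)[OF h] by (intro mult_pos_pos add_pos_nonneg) auto
  ultimately obtain W S where W: "radial_kernel TYPE('d) W S" and W0: "0 < W 0"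
    and super: "\<And>F (a :: int ^ 'd) c. finite F \<Longrightarrow>
       (\<Sum>b\<in>F. W (lnorm (a - b)) * V (lnorm (b - c))) \<le> W (lnorm (a - c)) / 2"
    using radial_kernel_supersolution[where 'd = 'd] by blast
  note W_mono = radial_kernelD(1)[OF W] and W_nonneg = radial_kernelD(2)[OF W]
  define \<gamma> where "\<gamma> = K * real (N ^ CARD('d)) * (2 * \<kappa> / W 0) * real (5 ^ CARD('d))"
  have \<gamma>: "0 \<le> \<gamma>" using K_ge1 \<kappa> W0 by (simp add: \<gamma>_def)
  \<comment> \<open>The shift by 3, truncated at 0, accounts for the radius 2 of \<open>B n\<close>
    and for the one cell lost in \<open>lnorm_le_quot\<close>.\<close>
  define \<Phi> where "\<Phi> r = \<gamma> * W (r div N - 3)" for r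
  \<comment> \<open>A summable majorant of the shifted \<open>W\<close>:
    \<open>r div 2 \<le> r - 3\<close> as soon as \<open>r > 4\<close>, and smaller radii are
    covered by the maximum \<open>W 0\<close>.\<close>
  define U where "U r = W 0 * (if r \<le> 4 then 1 else 0) + W (r div 2)" for r
  have "radial_kernel TYPE('d) U (W 0 * real ((2 * 4 + 1) ^ CARD('d)) + real ((2 * 2) ^ CARD('d)) * S)"
    unfolding U_def using W0
    by (intro radial_kernel_add radial_kernel_cmult radial_kernel_ball radial_kernel_div W) auto
  moreover have "W (r - 3) \<le> U r" for r
  proof (cases "r \<le> 4")
    case True
    then show ?thesis using W_mono[of 0 "r - 3"] W_nonneg by (simp add: U_def add_increasing2)
  next
    case False
    then have "r div 2 \<le> r - 3" by linarith
    then show ?thesis using W_mono False by (simp add: U_def)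
  qed
  ultimately have "radial_kernel TYPE('d) (\<lambda>r. W (r - 3))
      (W 0 * real ((2 * 4 + 1) ^ CARD('d)) + real ((2 * 2) ^ CARD('d)) * S)"
    by (rule radial_kernel_mono) (auto simp: antimono_def intro!: W_mono W_nonneg)
  from radial_kernel_cmult[OF radial_kernel_div[OF this N] \<gamma>]
  obtain S' where \<Phi>: "radial_kernel TYPE('d) \<Phi> S'" unfolding \<Phi>_def by blast
  note \<Phi>_nonneg = radial_kernelD(2)[OF \<Phi>]
  show thesis
  proof (rule that[OF \<Phi>])
    fix J :: "(int ^ 'd) set" and c :: "int ^ 'd \<Rightarrow> complex" and i
    assume J: "finite J" and i: "i \<in> J"
    define y where "y k = cmod (\<Sum>j\<in>J. A k j * c j)" for k
    define D where "D = local_avg N J (\<lambda>j. cmod (c j))"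
    have D0: "0 \<le> D p" for p by (simp add: D_def)
    define B where "B n = {k. lnorm (quot N k - n) \<le> 2}" for n :: "int ^ 'd"
    have finB: "finite (B n)" for n unfolding B_def quot_near_eq_cube[OF N] by simp
    define P where "P = quot N ` J"
    have finP: "finite P" using J by (simp add: P_def)
    define a where "a = quot N i"
    have aP: "a \<in> P" using i by (simp add: a_def P_def)
    have est: "D n \<le> \<kappa> * (\<Sum>k\<in>B n. y k) + (\<Sum>p\<in>P. V (lnorm (n - p)) * D p)" for n
      unfolding D_def y_def B_def P_def V_def
      by (rule local_estimate[OF h A C0 stab m L N_def tail \<delta>_le J \<kappa>_def])
    define T where "T = (\<Sum>n\<in>P. W (lnorm (a - n)) * (\<Sum>k\<in>B n. y k))"
    define X where "X = (\<Sum>n\<in>P. W (lnorm (a - n)) * D n)"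
    have "X \<le> (\<Sum>n\<in>P. W (lnorm (a - n)) * (\<kappa> * (\<Sum>k\<in>B n. y k) + (\<Sum>p\<in>P. V (lnorm (n - p)) * D p)))"
      unfolding X_def by (intro sum_mono mult_left_mono est W_nonneg)
    also have "\<dots> = \<kappa> * T + (\<Sum>n\<in>P. \<Sum>p\<in>P. W (lnorm (a - n)) * V (lnorm (n - p)) * D p)"
      unfolding T_def distrib_left sum.distrib
      by (simp add: sum_distrib_left mult.assoc mult.left_commute[of _ \<kappa>])
    also have "(\<Sum>n\<in>P. \<Sum>p\<in>P. W (lnorm (a - n)) * V (lnorm (n - p)) * D p)
       = (\<Sum>p\<in>P. (\<Sum>n\<in>P. W (lnorm (a - n)) * V (lnorm (n - p))) * D p)"
      by (subst sum.swap) (simp add: sum_distrib_right)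
    also have "\<dots> \<le> (\<Sum>p\<in>P. (W (lnorm (a - p)) / 2) * D p)"
      by (intro sum_mono mult_right_mono super finP D0)
    also have "\<dots> = X / 2" by (simp add: X_def sum_divide_distrib)
    \<comment> \<open>By \<open>super\<close> the kernel term has become \<open>X / 2\<close>; as
      \<open>X\<close> is a finite sum, it can be subtracted.\<close>
    finally have "X \<le> 2 * \<kappa> * T" by simp
    moreover have "W 0 * D a \<le> X"
    proof -
      have "W (lnorm (a - a)) * D a \<le> X"
        unfolding X_def by (rule member_le_sum[OF aP]) (use finP W_nonneg D0 in auto)
      then show ?thesis by simp
    qed
    ultimately have D_le: "D a \<le> (2 * \<kappa> / W 0) * T" using W0 by (simp add: field_simps)
    have "cmod (c i) \<le> (\<Sum>j\<in>{j\<in>J. quot N j = a}. cmod (c j))"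
      using J i by (intro member_le_sum) (auto simp: a_def)
    also have "\<dots> \<le> K * real (N ^ CARD('d)) * D a"
      unfolding D_def by (rule cell_sum_le_local_avg[OF N J]) simp
    also have "\<dots> \<le> K * real (N ^ CARD('d)) * ((2 * \<kappa> / W 0) * T)"
      using K_ge1 by (intro mult_left_mono D_le) auto
    finally have c_le: "cmod (c i) \<le> K * real (N ^ CARD('d)) * ((2 * \<kappa> / W 0) * T)" .
    define I where "I = (\<Union>n\<in>P. B n)"
    have finI: "finite I" unfolding I_def using finP finB by blast
    let ?g = "\<lambda>k. W (lnorm (i - k) div N - 3) * y k"
    have "T = (\<Sum>n\<in>P. \<Sum>k\<in>{k\<in>I. lnorm (quot N k - n) \<le> 2}. W (lnorm (a - n)) * y k)"
      unfolding T_def sum_distrib_left by (intro sum.cong) (auto simp: I_def B_def)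
    also have "\<dots> \<le> (\<Sum>n\<in>P. \<Sum>k\<in>{k\<in>I. lnorm (quot N k - n) \<le> 2}. ?g k)"
    proof (intro sum_mono mult_right_mono W_mono)
      fix n k assume "k \<in> {k\<in>I. lnorm (quot N k - n) \<le> 2}"
      then have "lnorm (n - quot N k) \<le> 2" by (simp add: lnorm_minus_commute)
      moreover have "lnorm (a - quot N k) \<le> lnorm (a - n) + lnorm (n - quot N k)" by (rule lnorm_triangle3)
      ultimately have "N * (lnorm (a - quot N k) + 1) \<le> N * (lnorm (a - n) + 3)"
        by (intro mult_le_mono) auto
      then have "lnorm (i - k) \<le> N * (lnorm (a - n) + 3)"
        using lnorm_le_quot[OF N, of i k] by (simp add: a_def)
      then have "lnorm (i - k) div N \<le> N * (lnorm (a - n) + 3) div N" by (rule div_le_mono)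
      then show "lnorm (i - k) div N - 3 \<le> lnorm (a - n)" using N by simp
    qed (simp add: y_def)
    also have "\<dots> \<le> real ((2 * 2 + 1) ^ CARD('d)) * (\<Sum>k\<in>I. ?g k)"
      using W_nonneg by (intro overlap_sum_le finP finI) (auto simp: y_def)
    finally have "K * real (N ^ CARD('d)) * ((2 * \<kappa> / W 0) * T)
      \<le> K * real (N ^ CARD('d)) * ((2 * \<kappa> / W 0) * (real (5 ^ CARD('d)) * (\<Sum>k\<in>I. ?g k)))"
      using K_ge1 \<kappa> W0 by (intro mult_left_mono) auto
    also have "\<dots> = (\<Sum>k\<in>I. \<Phi> (lnorm (i - k)) * y k)"
      by (simp add: \<Phi>_def \<gamma>_def sum_distrib_left mult_ac)
    finally show "\<exists>I. finite I \<and> cmod (c i) \<le> (\<Sum>k\<in>I. \<Phi> (lnorm (i - k)) * cmod (\<Sum>j\<in>J. A k j * c j))"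
      using c_le finI unfolding y_def by (intro exI[of _ I]) auto
  qed
qed

end

subsection \<open>Hahn-Banach theorem\<close>

text \<open>Homogeneity is required as an inequality only, which is what infima supply directly.
  Equality follows by scaling back with \<open>inverse t\<close>.\<close>

definition sublinear :: "('v::real_vector \<Rightarrow> real) \<Rightarrow> bool" where
  "sublinear p \<longleftrightarrow> (\<forall>x y. p (x + y) \<le> p x + p y) \<and> (\<forall>t\<ge>0. \<forall>x. p (t *\<^sub>R x) \<le> t * p x)"

lemma sublinearD:
  assumes "sublinear p"
  shows "p (x + y) \<le> p x + p y" "0 \<le> t \<Longrightarrow> p (t *\<^sub>R x) = t * p x" "p 0 = 0" "- p (- x) \<le> p x"
proof -
  show add: "p (x + y) \<le> p x + p y" for x y using assms by (simp add: sublinear_def)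
  have le: "p (t *\<^sub>R x) \<le> t * p x" if "0 \<le> t" for t x using assms that by (simp add: sublinear_def)
  show p0: "p 0 = 0" using le[of 0 0] add[of 0 0] by simp
  show "- p (- x) \<le> p x" using add[of x "- x"] p0 by simp
  show "p (t *\<^sub>R x) = t * p x" if "0 \<le> t"
  proof (cases "t = 0")
    case False
    then have "t * p x = t * p (inverse t *\<^sub>R (t *\<^sub>R x))" by simp
    also have "\<dots> \<le> t * (inverse t * p (t *\<^sub>R x))" using that by (intro mult_left_mono le) auto
    also have "\<dots> = p (t *\<^sub>R x)" using False by simp
    finally show ?thesis using le[OF that, of x] by simp
  qed (simp add: p0)
qed

text \<open>It is enough that some member of the family lies below each required combination. This
  covers infima over a chain, over a ray and over a graph.\<close>

lemma sublinear_Inf: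
  fixes f :: "'i \<Rightarrow> 'v::real_vector \<Rightarrow> real"
  assumes ne: "I \<noteq> {}" and bdd: "\<And>x. bdd_below ((\<lambda>i. f i x) ` I)"
    and add: "\<And>i j x y. i \<in> I \<Longrightarrow> j \<in> I \<Longrightarrow> \<exists>k\<in>I. f k (x + y) \<le> f i x + f j y"
    and scale: "\<And>i t x. i \<in> I \<Longrightarrow> 0 \<le> t \<Longrightarrow> \<exists>k\<in>I. f k (t *\<^sub>R x) \<le> t * f i x"
  shows "sublinear (\<lambda>x. INF i\<in>I. f i x)"
  unfolding sublinear_def
proof (intro conjI allI impI)
  have low: "(INF i\<in>I. f i x) \<le> f i x" if "i \<in> I" for i x
    using that by (intro cINF_lower bdd)
  fix x y
  have *: "(INF i\<in>I. f i (x + y)) \<le> f i x + f j y" if "i \<in> I" "j \<in> I" for i j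
    using add[OF that] low order_trans by blast
  have "(INF i\<in>I. f i (x + y)) - f j y \<le> (INF i\<in>I. f i x)" if "j \<in> I" for j
    using *[OF _ that] ne by (intro cINF_greatest) (auto simp: diff_le_eq)
  then have "(INF i\<in>I. f i (x + y)) - (INF i\<in>I. f i x) \<le> (INF j\<in>I. f j y)"
    using ne by (intro cINF_greatest) (auto simp: algebra_simps)
  then show "(INF i\<in>I. f i (x + y)) \<le> (INF i\<in>I. f i x) + (INF i\<in>I. f i y)" by simp
next
  have low: "(INF i\<in>I. f i x) \<le> f i x" if "i \<in> I" for i x
    using that by (intro cINF_lower bdd)
  fix t :: real and x assume t: "0 \<le> t"
  have *: "(INF i\<in>I. f i (t *\<^sub>R x)) \<le> t * f i x" if "i \<in> I" for i
    using scale[OF that t] low order_trans by blast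
  show "(INF i\<in>I. f i (t *\<^sub>R x)) \<le> t * (INF i\<in>I. f i x)"
  proof (cases "t = 0")
    case True
    then show ?thesis using * ne by auto
  next
    case False
    with t have "t > 0" by simp
    then have "(INF i\<in>I. f i (t *\<^sub>R x)) / t \<le> (INF i\<in>I. f i x)"
      using * ne by (intro cINF_greatest) (auto simp: divide_le_eq mult.commute)
    then show ?thesis using \<open>t > 0\<close> by (simp add: divide_le_eq mult.commute)
  qed
qed

text \<open>A pointwise minimal sublinear functional is linear.\<close>

lemma sublinear_dominates_linear:
  fixes p :: "'v::real_vector \<Rightarrow> real"
  assumes p: "sublinear p"
  obtains F where "linear F" "\<And>x. F x \<le> p x"
proof -
  define A where "A = {s. sublinear s \<and> s \<le> p}"
  have "\<exists>m\<in>A. \<forall>a\<in>A. m \<ge> a \<longrightarrow> a = m"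
  proof (rule predicate_Zorn)
    show "partial_order_on A (relation_of (\<ge>) A)"
      by (intro partial_order_on_relation_ofI) auto
    fix C assume C: "C \<in> Chains (relation_of (\<ge>) A)"
    then have CA: "C \<subseteq> A" by (rule Chains_relation_of)
    have tot: "s \<le> s' \<or> s' \<le> s" if "s \<in> C" "s' \<in> C" for s s'
      using C that unfolding Chains_def relation_of_def by auto
    show "\<exists>u\<in>A. \<forall>a\<in>C. u \<le> a"
    proof (cases "C = {}")
      case True
      then show ?thesis using p by (intro bexI[of _ p]) (auto simp: A_def)
    next
      case False
      define u where "u x = (INF s\<in>C. s x)" for x
      have bdd: "bdd_below ((\<lambda>s. s x) ` C)" for x
      proof (rule bdd_belowI2)
        fix s assume "s \<in> C"
        then have s: "sublinear s" "s (- x) \<le> p (- x)" using CA by (auto simp: A_def le_fun_def)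
        show "- p (- x) \<le> s x" using sublinearD(4)[OF s(1), of x] s(2) by linarith
      qed
      have u_le: "u x \<le> s x" if "s \<in> C" for s x
        unfolding u_def using that by (intro cINF_lower bdd)
      have "sublinear u"
        unfolding u_def
      proof (rule sublinear_Inf[OF False bdd])
        fix s s' :: "'v \<Rightarrow> real" and x y :: 'v
        assume ss: "s \<in> C" "s' \<in> C"
        show "\<exists>k\<in>C. k (x + y) \<le> s x + s' y"
        proof (cases "s \<le> s'")
          case True
          have "s (x + y) \<le> s x + s y" using ss(1) CA sublinearD(1) by (auto simp: A_def)
          also have "s y \<le> s' y" using True by (simp add: le_fun_def)
          finally show ?thesis using ss by auto
        next
          case False
          then have "s' \<le> s" using tot[OF ss] by simp
          have "s' (x + y) \<le> s' x + s' y" using ss(2) CA sublinearD(1) by (auto simp: A_def)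
          also have "s' x \<le> s x" using \<open>s' \<le> s\<close> by (simp add: le_fun_def)
          finally show ?thesis using ss by auto
        qed
      next
        fix s :: "'v \<Rightarrow> real" and t :: real and x :: 'v
        assume "s \<in> C" "0 \<le> t"
        then show "\<exists>k\<in>C. k (t *\<^sub>R x) \<le> t * s x"
          using CA sublinearD(2)[of s t x] by (intro bexI[of _ s]) (auto simp: A_def)
      qed
      moreover have "u \<le> p"
      proof -
        obtain s where "s \<in> C" using False by blast
        then have "u \<le> s" "s \<le> p" using u_le CA by (auto simp: A_def le_fun_def)
        then show ?thesis by (rule order_trans)
      qed
      ultimately show ?thesis using u_le by (intro bexI[of _ u]) (auto simp: A_def le_fun_def)
    qed
  qed
  then obtain m where m: "sublinear m" "m \<le> p" and minimal: "\<And>a. sublinear a \<Longrightarrow> a \<le> m \<Longrightarrow> a = m"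
    unfolding A_def by (auto intro: order_trans)
  note mD = sublinearD[OF m(1)]
  have super: "m x + m z \<le> m (x + z)" for x z
  proof -
    \<comment> \<open>Taking \<open>t = 0\<close> shows \<open>r \<le> m\<close>, so minimality
      gives \<open>r = m\<close>; then \<open>t = 1\<close> is the superadditivity of
      \<open>m\<close>.\<close>
    define r where "r x = (INF t\<in>{0..}. m (x + t *\<^sub>R z) - t * m z)" for x
    have bdd: "bdd_below ((\<lambda>t. m (x + t *\<^sub>R z) - t * m z) ` {0..})" for x
    proof (rule bdd_belowI2)
      fix t :: real assume "t \<in> {0..}"
      then have "t * m z = m (t *\<^sub>R z)" using mD(2) by simp
      also have "\<dots> \<le> m (x + t *\<^sub>R z) + m (- x)" using mD(1)[of "x + t *\<^sub>R z" "- x"] by simp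
      finally show "- m (- x) \<le> m (x + t *\<^sub>R z) - t * m z" by simp
    qed
    have "sublinear r"
      unfolding r_def
    proof (rule sublinear_Inf[OF _ bdd])
      fix s t :: real and x y assume st: "s \<in> {0..}" "t \<in> {0..}"
      have "m (x + y + (s + t) *\<^sub>R z) \<le> m (x + s *\<^sub>R z) + m (y + t *\<^sub>R z)"
        using mD(1)[of "x + s *\<^sub>R z" "y + t *\<^sub>R z"] by (simp add: algebra_simps)
      then show "\<exists>k\<in>{0..}. m (x + y + k *\<^sub>R z) - k * m z
          \<le> m (x + s *\<^sub>R z) - s * m z + (m (y + t *\<^sub>R z) - t * m z)"
        using st by (intro bexI[of _ "s + t"]) (auto simp: algebra_simps)
    next
      fix s t :: real and x assume st: "s \<in> {0..}" "0 \<le> t"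
      have "m (t *\<^sub>R x + (t * s) *\<^sub>R z) = t * m (x + s *\<^sub>R z)"
        using mD(2)[OF st(2), of "x + s *\<^sub>R z"] by (simp add: scaleR_add_right)
      then show "\<exists>k\<in>{0..}. m (t *\<^sub>R x + k *\<^sub>R z) - k * m z \<le> t * (m (x + s *\<^sub>R z) - s * m z)"
        using st by (intro bexI[of _ "t * s"]) (auto simp: algebra_simps)
    qed auto
    moreover have r_le: "r x \<le> m (x + t *\<^sub>R z) - t * m z" if "0 \<le> t" for x t
      unfolding r_def using that by (intro cINF_lower bdd) auto
    then have "r \<le> m" using r_le[of 0] by (simp add: le_fun_def)
    ultimately have "r = m" by (intro minimal)
    then show ?thesis using r_le[of 1 x] by simp
  qed
  have add: "m (x + y) = m x + m y" for x y using super[of x y] mD(1)[of x y] by simp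
  have neg: "m (- x) = - m x" for x using add[of x "- x"] mD(3) by simp
  have "m (t *\<^sub>R x) = t *\<^sub>R m x" for t x
  proof (cases "0 \<le> t")
    case False
    then have "m ((- t) *\<^sub>R x) = (- t) * m x" by (intro mD(2)) simp
    then show ?thesis using neg[of "t *\<^sub>R x"] by simp
  qed (simp add: mD(2))
  then have "linear m" by (intro linearI add)
  moreover have "m x \<le> p x" for x using m(2) by (simp add: le_fun_def)
  ultimately show thesis by (rule that)
qed

text \<open>The functional to be extended is given by its graph \<open>G\<close>; domination by \<open>p\<close>
  makes \<open>G\<close> single-valued.\<close>

lemma hahn_banach:
  fixes p :: "'v::real_vector \<Rightarrow> real"
  assumes p: "sublinear p" and G: "subspace G" and dom: "\<And>y t. (y, t) \<in> G \<Longrightarrow> t \<le> p y"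
  obtains F where "linear F" "\<And>x. F x \<le> p x" "\<And>y t. (y, t) \<in> G \<Longrightarrow> F y = t"
proof -
  note pD = sublinearD[OF p]
  \<comment> \<open>The infimum over \<open>G\<close> lies below \<open>p\<close> and is at most
    \<open>t\<close> at \<open>y\<close> for each \<open>(y, t)\<close> in \<open>G\<close>. A
    linear functional below it inherits both bounds, and \<open>(- y, - t)\<close> turns the second
    into an equality.\<close>
  define f where "f = (\<lambda>(y, t) x. p (x - y) + t)"
  define r where "r x = (INF g\<in>G. f g x)" for x
  have bdd: "bdd_below ((\<lambda>g. f g x) ` G)" for x
  proof (rule bdd_belowI2)
    fix g assume "g \<in> G"
    moreover obtain y t where g: "g = (y, t)" by force
    ultimately have "(- y, - t) \<in> G" using subspace_neg[OF G, of g] by simp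
    then have "- t \<le> p (- y)" by (rule dom)
    also have "\<dots> \<le> p (x - y) + p (- x)" using pD(1)[of "x - y" "- x"] by simp
    finally show "- p (- x) \<le> f g x" by (simp add: f_def g)
  qed
  have r_le: "r x \<le> p (x - y) + t" if "(y, t) \<in> G" for x y t
    using cINF_lower[OF bdd that] by (simp add: r_def f_def)
  have "sublinear r"
    unfolding r_def
  proof (rule sublinear_Inf[OF _ bdd])
    show "G \<noteq> {}" using subspace_0[OF G] by blast
    fix g g' x x' assume g: "g \<in> G" "g' \<in> G"
    obtain y t y' t' where e: "g = (y, t)" "g' = (y', t')" by (metis surj_pair)
    have "p (x + x' - (y + y')) \<le> p (x - y) + p (x' - y')"
      using pD(1)[of "x - y" "x' - y'"] by (simp add: algebra_simps)
    then show "\<exists>k\<in>G. f k (x + x') \<le> f g x + f g' x'"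
      using subspace_add[OF G g] by (intro bexI[of _ "g + g'"]) (auto simp: e f_def)
  next
    fix g x and s :: real assume g: "g \<in> G" "0 \<le> s"
    obtain y t where e: "g = (y, t)" by (metis surj_pair)
    have "p (s *\<^sub>R x - s *\<^sub>R y) = s * p (x - y)"
      using pD(2)[OF g(2), of "x - y"] by (simp add: scaleR_diff_right)
    then show "\<exists>k\<in>G. f k (s *\<^sub>R x) \<le> s * f g x"
      using subspace_scale[OF G g(1), of s]
      by (intro bexI[of _ "s *\<^sub>R g"]) (auto simp: e f_def algebra_simps)
  qed
  then obtain F where F: "linear F" "\<And>x. F x \<le> r x" using sublinear_dominates_linear[of r] by metis
  show thesis
  proof (rule that[OF F(1)])
    show "F x \<le> p x" for x
      using F(2)[of x] r_le[of 0 0 x] subspace_0[OF G] by (simp add: zero_prod_def)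
    have le: "F y \<le> t" if "(y, t) \<in> G" for y t
      using F(2)[of y] r_le[OF that, of y] pD(3) by simp
    show "F y = t" if "(y, t) \<in> G" for y t
      using le[OF that] le[of "- y" "- t"] subspace_neg[OF G that] linear_neg[OF F(1), of y] by simp
  qed
qed

subsection \<open>Rows of the left inverse\<close>

text \<open>Discreteness makes every function on the lattice continuous. The type of bounded
  continuous functions then models l^infinity as the real vector space that
  \<open>hahn_banach\<close> needs.\<close>

lemma open_int_vec: "open (S :: (int ^ 'd::finite) set)"
  unfolding open_vec_def
proof
  fix x assume "x \<in> S"
  then show "\<exists>B. (\<forall>i. open (B i) \<and> x $ i \<in> B i) \<and> (\<forall>y. (\<forall>i. y $ i \<in> B i) \<longrightarrow> y \<in> S)"
    by (intro exI[of _ "\<lambda>i. {x $ i}"]) (auto simp: vec_eq_iff[symmetric] open_discrete)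
qed

lemma bcontfun_int_vec:
  fixes f :: "int ^ 'd::finite \<Rightarrow> complex"
  assumes "\<And>k. cmod (f k) \<le> B"
  shows "apply_bcontfun (Bcontfun f) = f"
proof (rule Bcontfun_inverse, rule bcontfun_normI)
  show "continuous_on UNIV f" by (simp add: continuous_on_open_invariant open_int_vec)
qed (rule assms)

lemma radial_kernel_summable:
  assumes "radial_kernel TYPE('d::finite) u S"
  shows "(\<lambda>k. u (lnorm ((i :: int ^ 'd) - k))) summable_on UNIV"
  using radial_kernelD[OF assms]
  by (intro nonneg_bdd_above_summable_on bdd_aboveI2[of _ _ S]) auto

lemma radial_kernel_summable_times:
  fixes y :: "int ^ 'd::finite \<Rightarrow> real"
  assumes u: "radial_kernel TYPE('d) u S" and y: "\<And>k. 0 \<le> y k" "\<And>k. y k \<le> B"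
  shows "(\<lambda>k. u (lnorm (i - k)) * y k) summable_on UNIV"
proof (rule nonneg_bdd_above_summable_on)
  show "0 \<le> u (lnorm (i - k)) * y k" for k using radial_kernelD(2)[OF u] y by simp
  show "bdd_above (sum (\<lambda>k. u (lnorm (i - k)) * y k) ` {F. F \<subseteq> UNIV \<and> finite F})"
  proof (rule bdd_aboveI2)
    fix F :: "(int ^ 'd) set" assume "F \<in> {F. F \<subseteq> UNIV \<and> finite F}"
    then have F: "finite F" by simp
    have B: "0 \<le> B" using y[of undefined] by simp
    have "(\<Sum>k\<in>F. u (lnorm (i - k)) * y k) \<le> (\<Sum>k\<in>F. u (lnorm (i - k)) * B)"
      using radial_kernelD(2)[OF u] y by (intro sum_mono mult_left_mono) auto
    also have "\<dots> = (\<Sum>k\<in>F. u (lnorm (i - k))) * B" by (simp add: sum_distrib_right)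
    also have "\<dots> \<le> S * B" using B by (intro mult_right_mono radial_kernelD(3)[OF u F])
    finally show "(\<Sum>k\<in>F. u (lnorm (i - k)) * y k) \<le> S * B" .
  qed
qed

text \<open>Hahn-Banach for the functional taking \<open>A c\<close> to \<open>Re (c i)\<close>,
  dominated through \<open>bound\<close> by a weighted l^1 seminorm \<open>p\<close>. Bounded
  sequences form the ambient space: each such \<open>A c\<close> is bounded, and \<open>p\<close> is
  finite on them because \<Phi> is summable.\<close>

lemma left_inverse_row:
  fixes A :: "'d::finite imatrix"
  assumes \<Phi>: "radial_kernel TYPE('d) \<Phi> S" and A: "\<And>k j. cmod (A k j) \<le> H"
    and bound: "\<And>J c. finite J \<Longrightarrow> i \<in> J \<Longrightarrow>
       \<exists>I. finite I \<and> cmod (c i) \<le> (\<Sum>k\<in>I. \<Phi> (lnorm (i - k)) * cmod (\<Sum>j\<in>J. A k j * c j))"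
  obtains b where "\<And>j. cmod (b j) \<le> \<Phi> (lnorm (i - j))"
    "\<And>k. (\<Sum>\<^sub>\<infinity>j. b j * A j k) = (if i = k then 1 else 0)"
proof -
  note \<Phi>0 = radial_kernelD(2)[OF \<Phi>]
  define \<phi> where "\<phi> j = \<Phi> (lnorm (i - j))" for j
  have \<phi>0: "0 \<le> \<phi> j" for j by (simp add: \<phi>_def \<Phi>0)
  define p :: "((int ^ 'd) \<Rightarrow>\<^sub>C complex) \<Rightarrow> real" where "p y = (\<Sum>\<^sub>\<infinity>j. \<phi> j * cmod (y j))" for y
  have sm: "(\<lambda>j. \<phi> j * cmod (apply_bcontfun y j)) summable_on UNIV" for y :: "(int ^ 'd) \<Rightarrow>\<^sub>C complex"
    unfolding \<phi>_def using norm_bounded[of y] by (intro radial_kernel_summable_times[OF \<Phi>]) auto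
  have p_nonneg: "0 \<le> p y" for y unfolding p_def using \<phi>0 by (intro infsum_nonneg) auto
  have "sublinear p"
    unfolding sublinear_def
  proof (intro conjI allI impI)
    fix x y :: "(int ^ 'd) \<Rightarrow>\<^sub>C complex"
    have "p (x + y) \<le> (\<Sum>\<^sub>\<infinity>j. \<phi> j * cmod (x j) + \<phi> j * cmod (y j))"
      unfolding p_def
    proof (rule infsum_mono[OF sm summable_on_add[OF sm sm]])
      fix j
      have "\<phi> j * cmod (x j + y j) \<le> \<phi> j * (cmod (x j) + cmod (y j))"
        by (intro mult_left_mono norm_triangle_ineq \<phi>0)
      then show "\<phi> j * cmod ((x + y) j) \<le> \<phi> j * cmod (x j) + \<phi> j * cmod (y j)"
        by (simp add: distrib_left)
    qed
    also have "\<dots> = p x + p y" unfolding p_def by (rule infsum_add[OF sm sm])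
    finally show "p (x + y) \<le> p x + p y" .
  next
    fix t :: real and x :: "(int ^ 'd) \<Rightarrow>\<^sub>C complex" assume "0 \<le> t"
    then have "p (t *\<^sub>R x) = (\<Sum>\<^sub>\<infinity>j. t * (\<phi> j * cmod (x j)))"
      unfolding p_def by (simp add: mult_ac)
    then show "p (t *\<^sub>R x) \<le> t * p x" by (simp add: p_def infsum_cmult_right')
  qed
  define a where "a J c k = (\<Sum>j\<in>J. A k j * c j)" for J :: "(int ^ 'd) set" and c k
  have a_bcf: "apply_bcontfun (Bcontfun (a J c)) = a J c" for J c
  proof (rule bcontfun_int_vec)
    fix k
    show "cmod (a J c k) \<le> (\<Sum>j\<in>J. H * cmod (c j))"
      unfolding a_def using A by (intro sum_norm_le) (auto simp: norm_mult intro: mult_right_mono)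
  qed
  define v where "v J c = (if i \<in> J then Re (c i) else 0)" for J :: "(int ^ 'd) set" and c :: "int ^ 'd \<Rightarrow> complex"
  define G where "G = {(Bcontfun (a J c), v J c) | J c. finite J}"
  \<comment> \<open>The same pair written over a larger index set, so that two elements of
    \<open>G\<close> can be added over the union of their index sets.\<close>
  have restrict: "(Bcontfun (a J c), v J c) = (Bcontfun (a J' c'), v J' c')"
    if "finite J'" "J \<subseteq> J'" "\<And>j. c' j = (if j \<in> J then c j else 0)" for J J' c c'
  proof -
    have "a J c = a J' c'"
      unfolding a_def using that by (intro ext sum.mono_neutral_cong_left) auto
    moreover have "v J c = v J' c'" using that by (auto simp: v_def)
    ultimately show ?thesis by simp
  qed
  have "subspace G"
  proof (rule subspaceI)
    have "Bcontfun (a {} c) = 0" "v {} c = 0" for c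
      by (auto simp: v_def intro!: bcontfun_eqI) (simp add: a_bcf a_def)
    then have "0 = (Bcontfun (a {} (\<lambda>_. 0)), v {} (\<lambda>_. 0))" by (simp add: zero_prod_def)
    then show "0 \<in> G" unfolding G_def by blast
  next
    fix g g' assume "g \<in> G" "g' \<in> G"
    then obtain J c J' c' where g: "finite J" "g = (Bcontfun (a J c), v J c)"
      "finite J'" "g' = (Bcontfun (a J' c'), v J' c')" by (auto simp: G_def)
    define d where "d = (\<lambda>j. if j \<in> J then c j else 0)"
    define d' where "d' = (\<lambda>j. if j \<in> J' then c' j else 0)"
    have g1: "g = (Bcontfun (a (J \<union> J') d), v (J \<union> J') d)"
      unfolding g(2) using g by (intro restrict) (auto simp: d_def)
    have g2: "g' = (Bcontfun (a (J \<union> J') d'), v (J \<union> J') d')"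
      unfolding g(4) using g by (intro restrict) (auto simp: d'_def)
    have "g + g' = (Bcontfun (a (J \<union> J') (\<lambda>j. d j + d' j)), v (J \<union> J') (\<lambda>j. d j + d' j))"
      unfolding g1 g2 plus_prod_def
      by (auto intro!: bcontfun_eqI simp: a_bcf v_def) (simp_all add: a_def distrib_left sum.distrib)
    then show "g + g' \<in> G" using g unfolding G_def by blast
  next
    fix s :: real and g assume "g \<in> G"
    then obtain J c where g: "finite J" "g = (Bcontfun (a J c), v J c)" by (auto simp: G_def)
    have "s *\<^sub>R g = (Bcontfun (a J (\<lambda>j. s *\<^sub>R c j)), v J (\<lambda>j. s *\<^sub>R c j))"
      unfolding g scaleR_prod_def
      by (auto intro!: bcontfun_eqI simp: a_bcf v_def) (simp add: a_def scaleR_sum_right)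
    then show "s *\<^sub>R g \<in> G" using g unfolding G_def by blast
  qed
  moreover have "t \<le> p y" if yt: "(y, t) \<in> G" for y t
  proof -
    obtain J c where J: "finite J" "y = Bcontfun (a J c)" "t = v J c" using yt by (auto simp: G_def)
    show ?thesis
    proof (cases "i \<in> J")
      case True
      obtain I where I: "finite I" "cmod (c i) \<le> (\<Sum>k\<in>I. \<Phi> (lnorm (i - k)) * cmod (\<Sum>j\<in>J. A k j * c j))"
        using bound[OF J(1) True] by blast
      have "t \<le> cmod (c i)" using True complex_Re_le_cmod by (simp add: J v_def)
      also have "\<dots> \<le> (\<Sum>k\<in>I. \<phi> k * cmod (y k))" using I by (simp add: J a_bcf a_def \<phi>_def)
      also have "\<dots> \<le> p y"
        unfolding p_def using I \<phi>0 by (intro finite_sum_le_infsum sm) auto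
      finally show ?thesis .
    qed (simp add: J v_def p_nonneg)
  qed
  ultimately obtain F where F: "linear F" "\<And>x. F x \<le> p x" "\<And>y t. (y, t) \<in> G \<Longrightarrow> F y = t"
    using hahn_banach[OF \<open>sublinear p\<close>, of G] by metis
  define e where "e z j = Bcontfun (\<lambda>k. if k = j then z else 0)" for z :: complex and j :: "int ^ 'd"
  have e: "apply_bcontfun (e z j) k = (if k = j then z else 0)" for z j k
    unfolding e_def by (subst bcontfun_int_vec[of _ "cmod z"]) auto
  \<comment> \<open>\<open>F\<close> is only real linear. Its values on the unit sequences with
    entries 1 and \<i> determine the complex coefficient for which
    \<open>F (e z j) = Re (b j * z)\<close>.\<close>
  define b where "b j = Complex (F (e 1 j)) (- F (e \<i> j))" for j
  have Fe: "F (e z j) = Re (b j * z)" for z j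
  proof -
    have "e z j = Re z *\<^sub>R e 1 j + Im z *\<^sub>R e \<i> j"
      by (rule bcontfun_eqI) (auto simp: e complex_eq_iff)
    then show ?thesis by (simp add: b_def linear_add[OF F(1)] linear_scale[OF F(1)] mult.commute)
  qed
  have b_le: "cmod (b j) \<le> \<phi> j" for j
  proof (cases "b j = 0")
    case False
    have "p (e z j) = \<phi> j * cmod z" for z
    proof -
      have "p (e z j) = (\<Sum>\<^sub>\<infinity>k\<in>{j}. \<phi> k * cmod (e z j k))"
        unfolding p_def by (rule infsum_cong_neutral) (auto simp: e)
      then show ?thesis by (simp add: e)
    qed
    \<comment> \<open>Testing with the entry \<open>cnj (b j)\<close> turns the one-sided bound by
      \<open>p\<close> into a bound on the modulus.\<close>
    then have "Re (b j * cnj (b j)) \<le> \<phi> j * cmod (b j)"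
      using F(2)[of "e (cnj (b j)) j"] by (simp add: Fe)
    then have "cmod (b j) * cmod (b j) \<le> \<phi> j * cmod (b j)"
      by (simp add: power2_eq_square flip: complex_norm_square of_real_mult)
    then show ?thesis using False by (simp add: mult_le_cancel_right)
  qed (simp add: \<phi>0)
  have F_sum: "((\<lambda>j. Re (b j * y j)) has_sum F y) UNIV" for y :: "(int ^ 'd) \<Rightarrow>\<^sub>C complex"
  proof -
    have hs: "((\<lambda>j. \<phi> j * cmod (y j)) has_sum p y) UNIV"
      unfolding p_def by (rule has_sum_infsum[OF sm])
    \<comment> \<open>Removing the coordinates in \<open>T\<close> leaves a sequence whose
      \<open>p\<close>-value is the tail of the series for \<open>p y\<close>. Hence
      \<open>F\<close> has no part concentrated at infinity.\<close>
    have bd: "norm ((\<Sum>j\<in>T. Re (b j * y j)) - F y) \<le> p y - (\<Sum>j\<in>T. \<phi> j * cmod (y j))"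
      if T: "finite T" for T
    proof -
      define r where "r = y - (\<Sum>j\<in>T. e (y j) j)"
      have app: "apply_bcontfun (\<Sum>j\<in>T. e (y j) j) k = (\<Sum>j\<in>T. e (y j) j k)" for k
        using T by induction auto
      have r: "r k = (if k \<in> T then 0 else y k)" for k
        using T by (simp add: r_def app e)
      have neg: "p (- z) = p z" for z by (simp add: p_def)
      have "F r = F y - (\<Sum>j\<in>T. Re (b j * y j))"
        by (simp add: r_def linear_diff[OF F(1)] linear_sum[OF F(1)] Fe)
      moreover have "\<bar>F r\<bar> \<le> p r"
        using F(2)[of r] F(2)[of "- r"] by (simp add: linear_neg[OF F(1)] neg)
      moreover have "p r = p y - (\<Sum>j\<in>T. \<phi> j * cmod (y j))"
      proof -
        have "((\<lambda>j. if j \<in> T then \<phi> j * cmod (y j) else 0) has_sum (\<Sum>j\<in>T. \<phi> j * cmod (y j))) UNIV"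
          using has_sum_finite[OF T, of "\<lambda>j. \<phi> j * cmod (y j)"]
          by (subst has_sum_cong_neutral[where g = "\<lambda>j. \<phi> j * cmod (y j)" and T = T]) auto
        then have "((\<lambda>j. - (if j \<in> T then \<phi> j * cmod (y j) else 0)) has_sum - (\<Sum>j\<in>T. \<phi> j * cmod (y j))) UNIV"
          by (simp only: has_sum_uminus minus_minus)
        from has_sum_add[OF hs this]
        have "((\<lambda>j. \<phi> j * cmod (r j)) has_sum p y + - (\<Sum>j\<in>T. \<phi> j * cmod (y j))) UNIV"
          by (rule has_sum_cong[THEN iffD1, rotated]) (auto simp: r)
        then show ?thesis unfolding p_def[of r] by (simp add: infsumI)
      qed
      ultimately show ?thesis by simp
    qed
    have "((\<lambda>T. p y - (\<Sum>j\<in>T. \<phi> j * cmod (y j))) \<longlongrightarrow> p y - p y) (finite_subsets_at_top UNIV)"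
      using hs unfolding has_sum_def by (intro tendsto_diff tendsto_const)
    then have "((\<lambda>T. p y - (\<Sum>j\<in>T. \<phi> j * cmod (y j))) \<longlongrightarrow> 0) (finite_subsets_at_top UNIV)" by simp
    then have "((\<lambda>T. (\<Sum>j\<in>T. Re (b j * y j)) - F y) \<longlongrightarrow> 0) (finite_subsets_at_top UNIV)"
      by (rule Lim_null_comparison[rotated]) (rule eventually_finite_subsets_at_top_weakI, rule bd)
    then show ?thesis unfolding has_sum_def by (simp add: LIM_zero_iff)
  qed
  show thesis
  proof (rule that[of b])
    show "cmod (b j) \<le> \<Phi> (lnorm (i - j))" for j using b_le[of j] by (simp add: \<phi>_def)
    fix k
    have "(\<lambda>j. norm (b j * A j k)) summable_on UNIV"
    proof (rule Infinite_Sum.abs_summable_on_comparison_test[where g = "\<lambda>j. \<phi> j * H"])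
      have H0: "0 \<le> H" using A[of k k] norm_ge_zero order_trans by blast
      have "(\<lambda>j. \<phi> j * H) summable_on UNIV"
        unfolding \<phi>_def by (intro summable_on_cmult_left radial_kernel_summable[OF \<Phi>])
      then show "(\<lambda>j. norm (\<phi> j * H)) summable_on UNIV" using H0 \<phi>0 by simp
      show "norm (b j * A j k) \<le> norm (\<phi> j * H)" for j
        using b_le[of j] A[of j k] H0 \<phi>0 by (simp add: norm_mult mult_mono)
    qed
    then have summ: "(\<lambda>j. b j * A j k) summable_on UNIV" by (rule Infinite_Sum.abs_summable_summable)
    \<comment> \<open>The test sequence is \<open>z\<close> times column \<open>k\<close> of
      \<open>A\<close>. The choices 1 and \<open>- \<i>\<close> for \<open>z\<close> yield the real
      and the imaginary part.\<close>
    have sum_z: "(\<Sum>\<^sub>\<infinity>j. Re (b j * A j k * z)) = (if i = k then Re z else 0)" for z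
    proof -
      have "(Bcontfun (a {k} (\<lambda>_. z)), v {k} (\<lambda>_. z)) \<in> G" unfolding G_def by blast
      then have "F (Bcontfun (a {k} (\<lambda>_. z))) = v {k} (\<lambda>_. z)" by (rule F(3))
      then show ?thesis
        using infsumI[OF F_sum[of "Bcontfun (a {k} (\<lambda>_. z))"]]
        by (simp only: a_bcf) (simp add: a_def v_def mult.assoc del: times_complex.sel)
    qed
    have "Re (\<Sum>\<^sub>\<infinity>j. b j * A j k) = (if i = k then 1 else 0)"
      using sum_z[of 1] infsum_Re[OF summ] by (simp only: mult_1_right one_complex.sel)
    moreover have "Re (x * - \<i>) = Im x" for x by simp
    then have "Im (\<Sum>\<^sub>\<infinity>j. b j * A j k) = 0"
      using sum_z[of "- \<i>"] infsum_Im[OF summ] by (simp only: uminus_complex.sel imaginary_unit.sel) simp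
    ultimately show "(\<Sum>\<^sub>\<infinity>j. b j * A j k) = (if i = k then 1 else 0)"
      by (simp only: complex_eq_iff if_distrib[of Re] if_distrib[of Im]) simp
  qed
qed

subsection \<open>Stability and left inverses\<close>

context muckenhoupt
begin

text \<open>\<open>convolution_bound\<close> is uniform in the finite sets. A singleton
  \<open>I\<close> and \<open>w i > 0\<close> give convergence of the inner sums; then
  \<open>J\<close> is exhausted with \<open>I\<close> fixed, and finally \<open>I\<close>
  grows.\<close>

lemma convolution_infsum:
  assumes u: "radial_kernel TYPE('d) u S" and x0: "\<And>j. 0 \<le> x j"
    and x: "(\<lambda>j. x j powr q * w j) summable_on UNIV"
  defines "y \<equiv> \<lambda>i. \<Sum>\<^sub>\<infinity>j. u (lnorm (i - j)) * x j"
  shows "(\<lambda>j. u (lnorm (i - j)) * x j) summable_on UNIV"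
    and "(\<lambda>i. y i powr q * w i) summable_on UNIV"
    and "(\<Sum>\<^sub>\<infinity>i. y i powr q * w i) \<le> conv_const * S powr q * (\<Sum>\<^sub>\<infinity>j. x j powr q * w j)"
proof -
  define M where "M = conv_const * S powr q * (\<Sum>\<^sub>\<infinity>j. x j powr q * w j)"
  note u0 = radial_kernelD(2)[OF u]
  have fin: "(\<Sum>i\<in>I. w i * (\<Sum>j\<in>J. u (lnorm (i - j)) * x j) powr q) \<le> M"
    if "finite I" "finite J" for I J
  proof -
    have "(\<Sum>i\<in>I. w i * (\<Sum>j\<in>J. u (lnorm (i - j)) * x j) powr q)
       \<le> conv_const * S powr q * (\<Sum>j\<in>J. x j powr q * w j)"
      by (rule convolution_bound[OF u that x0])
    also have "\<dots> \<le> M"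
      unfolding M_def using conv_const_ge1 that w_nonneg
      by (intro mult_left_mono finite_sum_le_infsum x) auto
    finally show ?thesis .
  qed
  have M0: "0 \<le> M" using fin[of "{}" "{}"] by simp
  show sm: "(\<lambda>j. u (lnorm (i - j)) * x j) summable_on UNIV" for i
  proof (rule nonneg_bdd_above_summable_on)
    show "0 \<le> u (lnorm (i - j)) * x j" for j using u0 x0 by simp
    show "bdd_above (sum (\<lambda>j. u (lnorm (i - j)) * x j) ` {F. F \<subseteq> UNIV \<and> finite F})"
    proof (rule bdd_aboveI2)
      fix F :: "(int ^ 'd) set" assume "F \<in> {F. F \<subseteq> UNIV \<and> finite F}"
      then have F: "finite F" by simp
      have "w i * (\<Sum>j\<in>F. u (lnorm (i - j)) * x j) powr q \<le> M"
        using fin[of "{i}" F] F by simp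
      then have "(\<Sum>j\<in>F. u (lnorm (i - j)) * x j) powr q \<le> M / w i"
        using w_pos[of i] by (simp add: le_divide_eq mult.commute)
      also have "\<dots> = ((M / w i) powr (1 / q)) powr q"
        using M0 w_pos[of i] q_ge1 by (simp add: powr_powr)
      finally have le: "(\<Sum>j\<in>F. u (lnorm (i - j)) * x j) powr q \<le> ((M / w i) powr (1 / q)) powr q" .
      show "(\<Sum>j\<in>F. u (lnorm (i - j)) * x j) \<le> (M / w i) powr (1 / q)"
        by (rule powr_le_cancel_base[OF le]) (use q_ge1 in auto)
    qed
  qed
  have y0: "0 \<le> y i" for i unfolding y_def using u0 x0 by (intro infsum_nonneg) auto
  have fin': "(\<Sum>i\<in>I. y i powr q * w i) \<le> M" if I: "finite I" for I
  proof -
    have "((\<lambda>J. \<Sum>i\<in>I. w i * (\<Sum>j\<in>J. u (lnorm (i - j)) * x j) powr q)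
        \<longlongrightarrow> (\<Sum>i\<in>I. w i * y i powr q)) (finite_subsets_at_top UNIV)"
    proof (intro tendsto_sum tendsto_mult_left tendsto_powr')
      fix i
      show "((\<lambda>J. \<Sum>j\<in>J. u (lnorm (i - j)) * x j) \<longlongrightarrow> y i) (finite_subsets_at_top UNIV)"
        unfolding y_def by (intro infsum_tendsto sm)
      show "y i \<noteq> 0 \<or> 0 < q \<and>
          (\<forall>\<^sub>F J in finite_subsets_at_top UNIV. 0 \<le> (\<Sum>j\<in>J. u (lnorm (i - j)) * x j))"
        using q_ge1 u0 x0 by (auto intro!: always_eventually sum_nonneg)
    qed (rule tendsto_const)
    then have "(\<Sum>i\<in>I. w i * y i powr q) \<le> M"
      by (rule tendsto_upperbound)
        (auto intro!: eventually_finite_subsets_at_top_weakI fin I)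
    then show ?thesis by (simp add: mult.commute)
  qed
  show summ: "(\<lambda>i. y i powr q * w i) summable_on UNIV"
    using w_nonneg by (intro nonneg_bdd_above_summable_on bdd_aboveI2[of _ _ M]) (auto intro: fin')
  then show "(\<Sum>\<^sub>\<infinity>i. y i powr q * w i) \<le> conv_const * S powr q * (\<Sum>\<^sub>\<infinity>j. x j powr q * w j)"
    unfolding M_def[symmetric] by (intro infsum_le_finite_sums fin') auto
qed

lemma wlq_norm_mono:
  assumes "f \<in> wlq q w" "\<And>i. cmod (g i) \<le> cmod (f i)"
  shows "g \<in> wlq q w" "wlq_norm q w g \<le> wlq_norm q w f"
proof -
  have f: "(\<lambda>i. cmod (f i) powr q * w i) summable_on UNIV" using assms by (simp add: wlq_def)
  have le: "cmod (g i) powr q * w i \<le> cmod (f i) powr q * w i" for i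
    using assms q_ge1 w_nonneg by (intro mult_right_mono powr_mono2) auto
  have g: "(\<lambda>i. cmod (g i) powr q * w i) summable_on UNIV"
    by (rule summable_on_comparison_test[OF f]) (auto intro: le simp: w_nonneg)
  then show "g \<in> wlq q w" by (simp add: wlq_def)
  show "wlq_norm q w g \<le> wlq_norm q w f"
    unfolding wlq_norm_def using q_ge1 w_nonneg
    by (intro powr_mono2 infsum_mono f g le infsum_nonneg) auto
qed

lemma imat_apply_bounded:
  fixes A :: "'d imatrix"
  assumes h: "radial_kernel TYPE('d) h H" and A: "\<And>i j. cmod (A i j) \<le> h (lnorm (i - j))"
    and c: "c \<in> wlq q w"
  shows "(\<lambda>j. norm (A i j * c j)) summable_on UNIV"
    and "(\<lambda>i. of_real (\<Sum>\<^sub>\<infinity>j. h (lnorm (i - j)) * cmod (c j))) \<in> wlq q w"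
    and "imat_apply A c \<in> wlq q w"
    and "wlq_norm q w (imat_apply A c) \<le> (conv_const * H powr q) powr (1 / q) * wlq_norm q w c"
proof -
  have x: "(\<lambda>j. cmod (c j) powr q * w j) summable_on UNIV" using c by (simp add: wlq_def)
  note ci = convolution_infsum[OF h norm_ge_zero x]
  define y where "y i = (\<Sum>\<^sub>\<infinity>j. h (lnorm (i - j)) * cmod (c j))" for i
  have y0: "0 \<le> y i" for i
    unfolding y_def using radial_kernelD(2)[OF h] by (intro infsum_nonneg) auto
  have le: "norm (A i j * c j) \<le> h (lnorm (i - j)) * cmod (c j)" for i j
    by (simp add: norm_mult A mult_right_mono)
  show abs: "(\<lambda>j. norm (A i j * c j)) summable_on UNIV" for i
    by (rule summable_on_comparison_test[OF ci(1)]) (auto intro: le)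
  show ywlq: "(\<lambda>i. of_real (\<Sum>\<^sub>\<infinity>j. h (lnorm (i - j)) * cmod (c j))) \<in> wlq q w"
    using ci(2) y0 by (simp add: wlq_def flip: y_def)
  have bd: "cmod (imat_apply A c i) \<le> cmod (of_real (\<Sum>\<^sub>\<infinity>j. h (lnorm (i - j)) * cmod (c j)))" for i
  proof -
    have "cmod (imat_apply A c i) \<le> (\<Sum>\<^sub>\<infinity>j. norm (A i j * c j))"
      unfolding imat_apply_def by (rule norm_infsum_bound[OF abs])
    also have "\<dots> \<le> y i" unfolding y_def by (intro infsum_mono abs ci(1) le)
    finally show ?thesis using y0[of i] by (simp flip: y_def)
  qed
  show "imat_apply A c \<in> wlq q w" by (rule wlq_norm_mono(1)[OF ywlq bd])
  have "wlq_norm q w (imat_apply A c) \<le> wlq_norm q w (\<lambda>i. of_real (y i))"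
    unfolding y_def by (rule wlq_norm_mono(2)[OF ywlq bd])
  also have "\<dots> = (\<Sum>\<^sub>\<infinity>i. y i powr q * w i) powr (1 / q)"
    using y0 by (simp add: wlq_norm_def)
  also have "\<dots> \<le> (conv_const * H powr q * (\<Sum>\<^sub>\<infinity>j. cmod (c j) powr q * w j)) powr (1 / q)"
    using ci(3) q_ge1 w_nonneg unfolding y_def by (intro powr_mono2 infsum_nonneg) auto
  also have "\<dots> = (conv_const * H powr q) powr (1 / q) * wlq_norm q w c"
    by (simp only: powr_mult wlq_norm_def)
  finally show "wlq_norm q w (imat_apply A c) \<le> (conv_const * H powr q) powr (1 / q) * wlq_norm q w c" .
qed

text \<open>Fubini's theorem: the double series is absolutely summable because its terms are
  dominated by two successive convolutions with radial kernels.\<close>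

lemma imat_apply_imat_mult:
  fixes A B :: "'d imatrix"
  assumes h: "radial_kernel TYPE('d) h H" and A: "\<And>i j. cmod (A i j) \<le> h (lnorm (i - j))"
    and h': "radial_kernel TYPE('d) h' H'" and B: "\<And>i j. cmod (B i j) \<le> h' (lnorm (i - j))"
    and c: "c \<in> wlq q w"
  shows "imat_apply B (imat_apply A c) = imat_apply (imat_mult B A) c"
proof
  fix i
  note Ac = imat_apply_bounded[OF h A c]
  define y where "y k = (\<Sum>\<^sub>\<infinity>j. h (lnorm (k - j)) * cmod (c j))" for k
  have x: "(\<lambda>j. cmod (c j) powr q * w j) summable_on UNIV" using c by (simp add: wlq_def)
  note ci = convolution_infsum[OF h norm_ge_zero x]
  have y0: "0 \<le> y k" for k
    unfolding y_def using radial_kernelD(2)[OF h] by (intro infsum_nonneg) auto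
  have y: "(\<lambda>k. y k powr q * w k) summable_on UNIV" unfolding y_def by (rule ci(2))
  have inner: "(\<Sum>\<^sub>\<infinity>j. norm (A k j * c j)) \<le> y k" for k
    unfolding y_def
    by (intro infsum_mono Ac(1) ci(1)) (simp add: norm_mult A mult_right_mono)
  have "(\<lambda>kj. norm (case kj of (k, j) \<Rightarrow> B i k * (A k j * c j))) summable_on UNIV \<times> UNIV"
  proof (subst Infinite_Sum.abs_summable_on_Sigma_iff, intro conjI ballI)
    show "(\<lambda>j. norm (case (k, j) of (k, j) \<Rightarrow> B i k * (A k j * c j))) summable_on UNIV" for k
      using summable_on_cmult_right[OF Ac(1), of "cmod (B i k)" k] by (simp add: norm_mult mult_ac)
    have "(\<lambda>k. cmod (B i k) * (\<Sum>\<^sub>\<infinity>j. norm (A k j * c j))) summable_on UNIV"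
    proof (rule summable_on_comparison_test[OF convolution_infsum(1)[OF h' y0 y, of i]])
      show "cmod (B i k) * (\<Sum>\<^sub>\<infinity>j. norm (A k j * c j)) \<le> h' (lnorm (i - k)) * y k" for k
        using B inner radial_kernelD(2)[OF h'] by (intro mult_mono) (auto intro!: infsum_nonneg)
    qed (auto intro!: infsum_nonneg mult_nonneg_nonneg)
    then show "(\<lambda>k. norm (\<Sum>\<^sub>\<infinity>j. norm (case (k, j) of (k, j) \<Rightarrow> B i k * (A k j * c j)))) summable_on UNIV"
      by (simp add: norm_mult infsum_cmult_right' infsum_nonneg abs_mult)
  qed
  then have summ: "(\<lambda>(k, j). B i k * (A k j * c j)) summable_on UNIV \<times> UNIV"
    by (rule Infinite_Sum.abs_summable_summable)
  have "imat_apply B (imat_apply A c) i = (\<Sum>\<^sub>\<infinity>k. \<Sum>\<^sub>\<infinity>j. B i k * (A k j * c j))"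
    unfolding imat_apply_def by (simp add: infsum_cmult_right')
  also have "\<dots> = (\<Sum>\<^sub>\<infinity>j. \<Sum>\<^sub>\<infinity>k. B i k * (A k j * c j))"
    by (rule infsum_swap_banach[OF summ])
  also have "\<dots> = imat_apply (imat_mult B A) c i"
    unfolding imat_apply_def imat_mult_def by (simp add: mult.assoc flip: infsum_cmult_left')
  finally show "imat_apply B (imat_apply A c) i = imat_apply (imat_mult B A) c i" .
qed

lemma imat_apply_id: "imat_apply imat_id c = c"
proof
  fix i
  have "imat_apply imat_id c i = (\<Sum>\<^sub>\<infinity>j\<in>{i}. c j)"
    unfolding imat_apply_def by (rule infsum_cong_neutral) (auto simp: imat_id_def)
  then show "imat_apply imat_id c i = c i" by simp
qed

lemma left_inverse_imp_stable:
  fixes A B :: "'d imatrix"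
  assumes A: "A \<in> beurling_class" and B: "B \<in> beurling_class" and inv: "imat_mult B A = imat_id"
  shows "wlq_stable q w A"
proof -
  obtain h H where h: "radial_kernel TYPE('d) h H" "\<And>i j. cmod (A i j) \<le> h (lnorm (i - j))"
    using beurling_classE[OF A] by metis
  obtain h' H' where h': "radial_kernel TYPE('d) h' H'" "\<And>i j. cmod (B i j) \<le> h' (lnorm (i - j))"
    using beurling_classE[OF B] by metis
  define a where "a = (conv_const * H powr q) powr (1 / q)"
  define b where "b = (conv_const * H' powr q) powr (1 / q)"
  have ab: "0 \<le> a" "0 \<le> b" by (simp_all add: a_def b_def)
  define C where "C = a + b + 1"
  have C: "0 < C" "a \<le> C" "b \<le> C" using ab by (auto simp: C_def)
  have nn: "0 \<le> wlq_norm q w c" for c by (simp add: wlq_norm_def)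
  show ?thesis
    unfolding wlq_stable_def
  proof (intro exI[of _ C] conjI ballI allI)
    fix c assume c: "c \<in> wlq q w"
    note Ac = imat_apply_bounded[OF h c]
    show "(\<lambda>j. A i j * c j) summable_on UNIV" for i
      by (rule Infinite_Sum.abs_summable_summable) (rule Ac(1))
    show "imat_apply A c \<in> wlq q w" by (rule Ac(3))
    have "wlq_norm q w (imat_apply A c) \<le> a * wlq_norm q w c" using Ac(4) by (simp add: a_def)
    also have "\<dots> \<le> C * wlq_norm q w c" using C nn by (intro mult_right_mono)
    finally show "wlq_norm q w (imat_apply A c) \<le> C * wlq_norm q w c" .
    have "c = imat_apply B (imat_apply A c)"
      using imat_apply_imat_mult[OF h h' c] by (simp add: inv imat_apply_id)
    then have "wlq_norm q w c \<le> b * wlq_norm q w (imat_apply A c)"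
      using imat_apply_bounded(4)[OF h' Ac(3)] by (simp add: b_def)
    also have "\<dots> \<le> C * wlq_norm q w (imat_apply A c)" using C nn by (intro mult_right_mono)
    finally show "inverse C * wlq_norm q w c \<le> wlq_norm q w (imat_apply A c)"
      using C by (simp add: field_simps)
  qed (rule C)
qed

lemma stable_imp_left_inverse:
  fixes A :: "'d imatrix"
  assumes A: "A \<in> beurling_class" and stable: "wlq_stable q w A"
  shows "\<exists>B \<in> beurling_class. imat_mult B A = imat_id"
proof -
  obtain h H where h: "radial_kernel TYPE('d) h H" "\<And>i j. cmod (A i j) \<le> h (lnorm (i - j))"
    using beurling_classE[OF A] by metis
  obtain C where C: "0 < C" and st: "\<And>c. c \<in> wlq q w \<Longrightarrow> imat_apply A c \<in> wlq q w"
    "\<And>c. c \<in> wlq q w \<Longrightarrow> inverse C * wlq_norm q w c \<le> wlq_norm q w (imat_apply A c)"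
    using stable by (auto simp: wlq_stable_def)
  \<comment> \<open>Stability for finite supports, with \<open>T\<close> dominating all finite
    partial sums of the \<open>q\<close>-th power of the norm. In this form no infinite sum enters
    the localisation.\<close>
  have stab: "(\<Sum>j\<in>J. cmod (c j) powr q * w j) \<le> C powr q * T"
    if J: "finite J"
      and T: "\<And>I. finite I \<Longrightarrow> (\<Sum>i\<in>I. w i * cmod (\<Sum>j\<in>J. A i j * c j) powr q) \<le> T"
    for J and c :: "int ^ 'd \<Rightarrow> complex" and T
  proof -
    define c' where "c' j = (if j \<in> J then c j else 0)" for j
    have hs: "((\<lambda>j. cmod (c' j) powr q * w j) has_sum (\<Sum>j\<in>J. cmod (c j) powr q * w j)) UNIV"
      using has_sum_finite[OF J, of "\<lambda>j. cmod (c j) powr q * w j"]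
      by (subst has_sum_cong_neutral[where g = "\<lambda>j. cmod (c j) powr q * w j" and T = J]) (auto simp: c'_def)
    have c': "c' \<in> wlq q w" using hs by (auto simp: wlq_def summable_on_def)
    have norm_c': "wlq_norm q w c' = (\<Sum>j\<in>J. cmod (c j) powr q * w j) powr (1 / q)"
      using infsumI[OF hs] by (simp add: wlq_norm_def)
    have app: "imat_apply A c' i = (\<Sum>j\<in>J. A i j * c j)" for i
    proof -
      have "imat_apply A c' i = (\<Sum>\<^sub>\<infinity>j\<in>J. A i j * c j)"
        unfolding imat_apply_def by (rule infsum_cong_neutral) (auto simp: c'_def)
      then show ?thesis using J by simp
    qed
    have T0: "0 \<le> T" using T[of "{}"] by simp
    have "(\<Sum>\<^sub>\<infinity>i. cmod (imat_apply A c' i) powr q * w i) \<le> T"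
      using st(1)[OF c'] T by (intro infsum_le_finite_sums) (auto simp: wlq_def app mult.commute)
    then have "wlq_norm q w (imat_apply A c') \<le> T powr (1 / q)"
      unfolding wlq_norm_def using q_ge1 w_nonneg by (intro powr_mono2 infsum_nonneg) auto
    moreover have "wlq_norm q w c' \<le> C * wlq_norm q w (imat_apply A c')"
      using st(2)[OF c'] C by (simp add: field_simps)
    ultimately have "wlq_norm q w c' \<le> C * T powr (1 / q)"
      using C by (meson mult_left_mono less_imp_le order_trans)
    then have "wlq_norm q w c' powr q \<le> (C * T powr (1 / q)) powr q"
      using q_ge1 by (intro powr_mono2) (auto simp: wlq_norm_def)
    then show ?thesis
      using q_ge1 T0 w_nonneg by (simp add: norm_c' powr_powr powr_mult sum_nonneg)
  qed
  have A_le: "cmod (A k j) \<le> h 0" for k j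
    using h(2)[of k j] radial_kernelD(1)[OF h(1) le0] by (rule order_trans)
  show ?thesis
  proof (rule pointwise_bound[OF h powr_ge_zero stab])
    fix \<Phi> S
    assume \<Phi>: "radial_kernel TYPE('d) \<Phi> S" and bound:
      "\<And>J c i. finite J \<Longrightarrow> i \<in> J \<Longrightarrow>
         \<exists>I. finite I \<and> cmod (c i) \<le> (\<Sum>k\<in>I. \<Phi> (lnorm (i - k)) * cmod (\<Sum>j\<in>J. A k j * c j))"
    \<comment> \<open>One \<Phi> serves all \<open>i\<close>, so rows chosen independently of each
      other form a matrix of the class.\<close>
    have "\<exists>b. (\<forall>j. cmod (b j) \<le> \<Phi> (lnorm (i - j))) \<and>
        (\<forall>k. (\<Sum>\<^sub>\<infinity>j. b j * A j k) = (if i = k then 1 else 0))" for i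
    proof (rule left_inverse_row[OF \<Phi> A_le])
      show "\<exists>I. finite I \<and> cmod (c i) \<le> (\<Sum>k\<in>I. \<Phi> (lnorm (i - k)) * cmod (\<Sum>j\<in>J. A k j * c j))"
        if "finite J" "i \<in> J" for J c
        by (rule bound[OF that])
    qed blast
    then obtain B where B: "\<And>i j. cmod (B i j) \<le> \<Phi> (lnorm (i - j))"
      "\<And>i k. (\<Sum>\<^sub>\<infinity>j. B i j * A j k) = (if i = k then 1 else 0)" by metis
    have "imat_mult B A = imat_id" by (intro ext) (simp add: imat_mult_def imat_id_def B)
    moreover have "B \<in> beurling_class" by (rule beurling_classI[OF \<Phi> B(1)])
    ultimately show ?thesis by blast
  qed
qed

end

theorem corollary1p6:
  fixes q :: real and w :: "int ^ 'd::finite \<Rightarrow> real" and A :: "'d imatrix"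
  assumes "1 \<le> q"
    and "discrete_weight q w"
    and "A \<in> beurling_class"
  shows "wlq_stable q w A \<longleftrightarrow> (\<exists>B \<in> beurling_class. imat_mult B A = imat_id)"
proof -
  obtain K where "muckenhoupt q K w" by (rule discrete_weight_muckenhoupt[OF assms(1,2)])
  then interpret muckenhoupt q K w .
  show ?thesis using stable_imp_left_inverse left_inverse_imp_stable assms(3) by blast
qed

end
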